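(* Let $\alpha,b\ge2$ be integers. For any $x=vb^{-n}$ with $n\ge1$ and $v$ an integer with $0\le v<b^n$, the value $\omega_\alpha(vb^{-n})$ can be computed in at most $O(\alpha n)$ operations as follows. For $x=(0.\xi_1\xi_2\ldots\xi_n)_b=\sum_{i=1}^n\xi_ib^{-i}$ (with $\xi_i=0$ for $i>n$) set $$z(x,a)=\begin{cases}b-1&\text{if }\xi_{a+1}=0,\\-1&\text{if }\xi_{a+1}\ne0,\end{cases}\qquad \beta(x)=-\lfloor\log_b(x)\rfloor\quad(x\neq 0).$$ For $0<v<b^n$ calculate the vectors $$\boldsymbol T(x)=(T_{\alpha-1},\ldots,T_1),\qquad T_t=T_0^{n-1}(t)\Bigl(\prod_{i=1}^{t}b^{-(a_i+1)}z(x,a_i)\Bigr)\quad(1\le t\le\alpha-1),$$ $$\tilde{\boldsymbol T}(x)=(\tilde T_\alpha,\ldots,\tilde T_1),\qquad \tilde T_t=T_0^{n-1}(t)\Bigl(b^{a_t}\,[a_t\le\beta(x)-1]\prod_{i=1}^{t}b^{-(a_i+1)}z(x,a_i)\Bigr)\quad(1\le t\le\alpha),$$ both of which can be computed by the algorithm $\mathcal A$ described in the context, and set $$\boldsymbol C=(C_0,\ldots,C_{\alpha-1}),\quad C_t=b^{-nt}\prod_{i=1}^t\frac{b-1}{b^i-1},\qquad \bar{\boldsymbol C}=(\bar C_0,\ldots,\bar C_{\alpha-1}),\quad \bar C_t=C_0+\cdots+C_t,$$ where $C_0=\bar C_0=1$. Then $$\omega_\alpha(vb^{-n})=\begin{cases}\displaystyle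 \bar{\boldsymbol C}_{0:\alpha-2}\cdot\boldsymbol T(vb^{-n})+(\bar C_{\alpha-1}-1)+\boldsymbol C\cdot\tilde{\boldsymbol T}(vb^{-n})&\text{if }0<v<b^n,\\[2mm]\displaystyle\sum_{r=1}^{\alpha-1}\prod_{i=1}^r\frac{b-1}{b^i-1}+\frac{b-1}{b^\alpha-b}\prod_{i=1}^{\alpha-1}\frac{b-1}{b^i-1}&\text{if }v=0,\end{cases}$$ where $\bar{\boldsymbol C}_{0:\alpha-2}=(\bar C_0,\ldots,\bar C_{\alpha-2})$ and $\cdot$ denotes the dot product.
   Context: For $k\in\mathbb N$ write $k=\sum_{i=0}^a\kappa_ib^i$ with base $b$ digits $\kappa_i\in\{0,\ldots,b-1\}$; let $\#k$ be the number of non-zero digits and write $k=\sum_{i=1}^{\#k}\kappa_{a_i}b^{a_i}$ with $\kappa_{a_i}\ne0$, $a_1>\cdots>a_{\#k}\ge0$. Set $r_\alpha(k)=b^{-\sum_{i=1}^{\min(\#k,\alpha)}(a_i+1)}$. For $x=\sum_{i\ge1}\xi_ib^{-i}\in[0,1)$ (digits not eventually all $b-1$) set $\mathrm{wal}_k(x)=\exp(2\pi\mathrm i(\xi_1\kappa_0+\cdots+\xi_{a+1}\kappa_a)/b)$, and $\omega_\alpha(x)=\sum_{k=1}^\infty r_\alpha(k)\,\mathrm{wal}_k(x)$ (absolutely convergent for $\alpha\ge2$). Triangular sum operator: for integers $m\le M$ and $r\ge1$, $T_m^M(r)(g)=\sum_{M\ge a_1>a_2>\cdots>a_r\ge m}g(a_1,\ldots,a_r)$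 (an empty sum is $0$). $[\,P\,]$ is $1$ if $P$ is true and $0$ otherwise (Iverson bracket). Algorithm $\mathcal A$ (input: $n$, $r$ and functions $g_1,\ldots,g_r$ on $\{0,\ldots,n-1\}$; output: $S_t=T_0^{n-1}(r-t+1)\bigl(\prod_{i=t}^rg_i(a_i)\bigr)$ for $t=1,\ldots,r$): initialize $S_1=\cdots=S_r=0$; for $a=0,1,\ldots,n-1$: set $S_r\leftarrow S_r+g_r(a)$, then for $t=1,2,\ldots,\min(r,n-a)-1$ in this order set $S_{r-t}\leftarrow S_{r-t}+S_{r-t+1}\,g_{r-t}(a+t)$; return $(S_1,\ldots,S_r)$. For $\boldsymbol T(x)$ it is applied with $r=\alpha-1$ and $g_i(a)=b^{-(a+1)}z(x,a)$ for all $i$; for $\tilde{\boldsymbol T}(x)$ with $r=\alpha$, $g_i(a)=b^{-(a+1)}z(x,a)$ for $i<\alpha$ and $g_\alpha(a)=b^{a}[a\le\beta(x)-1]\,b^{-(a+1)}z(x,a)$. Operations are arithmetic operations on numbers and evaluations of the functions $g_i$; the implied constant is absolute. *)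

theory Defs
  imports Complex_Main
begin

section \<open>The function \<open>\<omega>\<^sub>\<alpha>\<close>\<close>

definition kdigit :: "nat \<Rightarrow> nat \<Rightarrow> nat \<Rightarrow> nat" where
  "kdigit b k i = (k div b ^ i) mod b"

definition nonzero_positions :: "nat \<Rightarrow> nat \<Rightarrow> nat list" where
  \<comment> \<open>the list \<open>[a\<^sub>1, a\<^sub>2, \<dots>]\<close> with \<open>a\<^sub>1 > a\<^sub>2 > \<dots>\<close>; its length is \<open>#k\<close>\<close>
  "nonzero_positions b k = rev (sorted_list_of_set {i. kdigit b k i \<noteq> 0})"

definition r_weight :: "nat \<Rightarrow> nat \<Rightarrow> nat \<Rightarrow> real" where
  \<comment> \<open>\<open>take \<alpha>\<close> keeps the first \<open>min #k \<alpha>\<close> positions\<close>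
  "r_weight \<alpha> b k = 1 / real b ^ (\<Sum>a\<leftarrow>take \<alpha> (nonzero_positions b k). a + 1)"

definition xdigit :: "nat \<Rightarrow> real \<Rightarrow> nat \<Rightarrow> nat" where
  \<comment> \<open>For \<open>x \<in> [0,1)\<close> and \<open>i \<ge> 1\<close> this is the digit \<open>\<xi>\<^sub>i\<close> in the expansion of \<open>x\<close> whose
     digits are not eventually all \<open>b - 1\<close>.\<close>
  "xdigit b x i = nat \<lfloor>x * real b ^ i\<rfloor> mod b"

definition wal :: "nat \<Rightarrow> nat \<Rightarrow> real \<Rightarrow> complex" where
  \<comment> \<open>for \<open>b \<ge> 2\<close> all digits of \<open>k\<close> at positions greater than \<open>k\<close> vanish\<close>
  "wal b k x = exp (2 * of_real pi * \<i> * of_nat (\<Sum>i\<le>k. xdigit b x (i + 1) * kdigit b k i) / of_nat b)"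

definition omega :: "nat \<Rightarrow> nat \<Rightarrow> real \<Rightarrow> complex" where
  "omega \<alpha> b x = (\<Sum>k. of_real (r_weight \<alpha> b (Suc k)) * wal b (Suc k) x)"


section \<open>Triangular sums and the vectors of the formula\<close>

text \<open>
  A tuple \<open>(a\<^sub>1, \<dots>, a\<^sub>r)\<close> is a list \<open>as\<close> of length \<open>r\<close>, so that \<open>a\<^sub>i\<close> is \<open>as ! (i - 1)\<close>.
\<close>

definition tri_sum :: "nat \<Rightarrow> nat \<Rightarrow> nat \<Rightarrow> (nat list \<Rightarrow> real) \<Rightarrow> real" where
  "tri_sum m M r g = (\<Sum>as | length as = r \<and> sorted_wrt (>) as \<and> set as \<subseteq> {m..M}. g as)"

definition z :: "nat \<Rightarrow> real \<Rightarrow> nat \<Rightarrow> real" where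
  "z b x a = (if xdigit b x (a + 1) = 0 then real b - 1 else - 1)"

definition beta :: "nat \<Rightarrow> real \<Rightarrow> int" where
  "beta b x = - \<lfloor>log (real b) x\<rfloor>"

definition T_entry :: "nat \<Rightarrow> nat \<Rightarrow> real \<Rightarrow> nat \<Rightarrow> real" where
  "T_entry b n x t = tri_sum 0 (n - 1) t (\<lambda>as. \<Prod>i<t. 1 / real b ^ (as ! i + 1) * z b x (as ! i))"

definition Tt_entry :: "nat \<Rightarrow> nat \<Rightarrow> real \<Rightarrow> nat \<Rightarrow> real" where
  "Tt_entry b n x t = tri_sum 0 (n - 1) t (\<lambda>as.
     real b ^ (as ! (t - 1)) * of_bool (int (as ! (t - 1)) \<le> beta b x - 1) *
     (\<Prod>i<t. 1 / real b ^ (as ! i + 1) * z b x (as ! i)))"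

definition T_vec :: "nat \<Rightarrow> nat \<Rightarrow> nat \<Rightarrow> real \<Rightarrow> real list" where
  "T_vec \<alpha> b n x = map (T_entry b n x) (rev [1..<\<alpha>])"

definition Tt_vec :: "nat \<Rightarrow> nat \<Rightarrow> nat \<Rightarrow> real \<Rightarrow> real list" where
  "Tt_vec \<alpha> b n x = map (Tt_entry b n x) (rev [1..<\<alpha> + 1])"

definition C_entry :: "nat \<Rightarrow> nat \<Rightarrow> nat \<Rightarrow> real" where
  "C_entry b n t = 1 / real b ^ (n * t) * (\<Prod>i=1..t. (real b - 1) / (real b ^ i - 1))"

definition Cbar_entry :: "nat \<Rightarrow> nat \<Rightarrow> nat \<Rightarrow> real" where
  "Cbar_entry b n t = (\<Sum>i\<le>t. C_entry b n i)"

definition C_vec :: "nat \<Rightarrow> nat \<Rightarrow> nat \<Rightarrow> real list" where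
  "C_vec \<alpha> b n = map (C_entry b n) [0..<\<alpha>]"

definition Cbar_vec :: "nat \<Rightarrow> nat \<Rightarrow> nat \<Rightarrow> real list" where
  "Cbar_vec \<alpha> b n = map (Cbar_entry b n) [0..<\<alpha>]"

definition dot :: "real list \<Rightarrow> real list \<Rightarrow> real" where
  "dot us vs = sum_list (map2 (*) us vs)"


section \<open>Programs and their operation count\<close>

text \<open>
  A program is a list of instructions on real-valued registers, with all loops unrolled. The only
  way to obtain new numbers is by loading a natural number constant, by one of the four arithmetic
  operations, or by evaluating one of the given functions, named by elements of the type \<open>'f\<close>,
  at a natural number. The first argument of every instruction is the register that is written.
  The number of operations of a program is its length (so loading a constant is counted as well).
\<close>

datatype reg =
    Base      \<comment> \<open>input register, holds \<open>b\<close>\<close>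
  | Out       \<comment> \<open>output register\<close>
  | One | BaseMinusOne | InvBaseN | PowBase | ProdReg | Tmp
  | RegS nat  \<comment> \<open>\<open>S\<^sub>1, S\<^sub>2, \<dots>\<close> in the run of the algorithm for \<open>T\<close>\<close>
  | RegSt nat \<comment> \<open>\<open>S\<^sub>1, S\<^sub>2, \<dots>\<close> in the run of the algorithm for the variant of \<open>T\<close> with the bracket\<close>
  | RegC nat
  | RegCbar nat

datatype 'f instr =
    Const reg nat
  | Add reg reg reg
  | Sub reg reg reg
  | Mul reg reg reg
  | Div reg reg reg
  | Eval reg 'f nat

fun exec :: "('f \<Rightarrow> nat \<Rightarrow> real) \<Rightarrow> 'f instr \<Rightarrow> (reg \<Rightarrow> real) \<Rightarrow> (reg \<Rightarrow> real)" where
  "exec g (Const d c) s = s(d := real c)"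
| "exec g (Add d p q) s = s(d := s p + s q)"
| "exec g (Sub d p q) s = s(d := s p - s q)"
| "exec g (Mul d p q) s = s(d := s p * s q)"
| "exec g (Div d p q) s = s(d := s p / s q)"
| "exec g (Eval d f a) s = s(d := g f a)"

definition run :: "('f \<Rightarrow> nat \<Rightarrow> real) \<Rightarrow> 'f instr list \<Rightarrow> (reg \<Rightarrow> real) \<Rightarrow> (reg \<Rightarrow> real)" where
  "run g p s = fold (exec g) p s"

text \<open>
  The algorithm for the triangular sums, with accumulators \<open>S 1, \<dots>, S r\<close> and with the functions
  named \<open>f 1, \<dots>, f r\<close>.
\<close>

definition alg_A :: "(nat \<Rightarrow> reg) \<Rightarrow> (nat \<Rightarrow> 'f) \<Rightarrow> nat \<Rightarrow> nat \<Rightarrow> 'f instr list" where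
  "alg_A S f n r =
     map (\<lambda>t. Const (S t) 0) [1..<r + 1] @
     concat (map (\<lambda>a.
       [Eval Tmp (f r) a,
        Add (S r) (S r) Tmp] @
       concat (map (\<lambda>t.
         [Eval Tmp (f (r - t)) (a + t),
          Mul Tmp (S (r - t + 1)) Tmp,
          Add (S (r - t)) (S (r - t)) Tmp]) [1..<min r (n - a)])) [0..<n])"

datatype fname = G nat | Gt nat

fun g_val :: "nat \<Rightarrow> nat \<Rightarrow> real \<Rightarrow> fname \<Rightarrow> nat \<Rightarrow> real" where
  "g_val \<alpha> b x (G i) a = 1 / real b ^ (a + 1) * z b x a"
| "g_val \<alpha> b x (Gt i) a =
     (if i < \<alpha> then 1 / real b ^ (a + 1) * z b x a
      else real b ^ a * of_bool (int a \<le> beta b x - 1) * (1 / real b ^ (a + 1) * z b x a))"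

definition prog_T :: "nat \<Rightarrow> nat \<Rightarrow> fname instr list" where
  "prog_T \<alpha> n = alg_A RegS G n (\<alpha> - 1)"

definition prog_Tt :: "nat \<Rightarrow> nat \<Rightarrow> fname instr list" where
  "prog_Tt \<alpha> n = alg_A RegSt Gt n \<alpha>"

text \<open>
  The entries of both coefficient vectors, by \<open>C\<^sub>t = C\<^sub>t\<^sub>-\<^sub>1 \<cdot> (b - 1) / (b\<^sup>t - 1) \<cdot> b\<^sup>-\<^sup>n\<close>.
\<close>

definition prog_C :: "nat \<Rightarrow> nat \<Rightarrow> fname instr list" where
  "prog_C \<alpha> n =
     [Const One 1, Const InvBaseN 1] @
     replicate n (Div InvBaseN InvBaseN Base) @
     [Sub BaseMinusOne Base One, Const PowBase 1, Const (RegC 0) 1, Const (RegCbar 0) 1] @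
     concat (map (\<lambda>t.
       [Mul PowBase PowBase Base,
        Sub Tmp PowBase One,
        Div Tmp BaseMinusOne Tmp,
        Mul Tmp Tmp InvBaseN,
        Mul (RegC t) (RegC (t - 1)) Tmp,
        Add (RegCbar t) (RegCbar (t - 1)) (RegC t)]) [1..<\<alpha>])"

text \<open>
  The entry of \<open>T_vec\<close> at the 0-based index \<open>t\<close> is in register \<open>RegS (t + 1)\<close>.
\<close>

definition prog_combine :: "nat \<Rightarrow> fname instr list" where
  "prog_combine \<alpha> =
     [Sub Out (RegCbar (\<alpha> - 1)) One] @
     concat (map (\<lambda>t. [Mul Tmp (RegCbar t) (RegS (t + 1)), Add Out Out Tmp]) [0..<\<alpha> - 1]) @
     concat (map (\<lambda>t. [Mul Tmp (RegC t) (RegSt (t + 1)), Add Out Out Tmp]) [0..<\<alpha>])"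

definition prog_zero :: "nat \<Rightarrow> fname instr list" where
  "prog_zero \<alpha> =
     [Const One 1, Sub BaseMinusOne Base One, Const PowBase 1, Const ProdReg 1, Const Out 0] @
     concat (map (\<lambda>r.
       [Mul PowBase PowBase Base,
        Sub Tmp PowBase One,
        Div Tmp BaseMinusOne Tmp,
        Mul ProdReg ProdReg Tmp,
        Add Out Out ProdReg]) [1..<\<alpha>]) @
     [Mul PowBase PowBase Base,
      Sub Tmp PowBase Base,
      Div Tmp BaseMinusOne Tmp,
      Mul Tmp Tmp ProdReg,
      Add Out Out Tmp]"

text \<open>
  The program depends on \<open>v\<close> only through the test \<open>v = 0\<close>, and not at all on \<open>b\<close>; otherwise it
  accesses these numbers only through the register \<open>Base\<close> and through the evaluated functions.
\<close>

definition omega_prog :: "nat \<Rightarrow> nat \<Rightarrow> nat \<Rightarrow> fname instr list" where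
  "omega_prog \<alpha> n v =
     (if v = 0 then prog_zero \<alpha>
      else prog_T \<alpha> n @ prog_Tt \<alpha> n @ prog_C \<alpha> n @ prog_combine \<alpha>)"

end

theory Submission
  imports Defs
begin

text \<open>
  Split the sum over \<open>k < b ^ (N + 1)\<close> according to the digit of \<open>k\<close> at position \<open>N\<close>. A non-zero
  leading digit lowers \<open>\<alpha>\<close> by one, and summing the character over it gives \<open>z(x, N)\<close>. Hence
  \<open>P\<^sub>\<alpha>(N) = (\<Sum>k<b\<^sup>N. r\<^sub>\<alpha>(k) wal\<^sub>k(x))\<close> satisfies
  \<open>P\<^sub>\<alpha>(N + 1) = P\<^sub>\<alpha>(N) + b\<^sup>-\<^sup>(\<^sup>N\<^sup>+\<^sup>1\<^sup>) z(x, N) P\<^sub>\<alpha>\<^sub>-\<^sub>1(N)\<close>, and \<open>P\<^sub>0(N)\<close> is \<open>b\<^sup>N\<close> or \<open>0\<close> according to whether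
  the first \<open>N\<close> digits of \<open>x\<close> vanish. The same recursion holds for the triangular sums, so they
  express \<open>P\<^sub>\<alpha>(n)\<close>. From position \<open>n\<close> on all digits of \<open>x\<close> are zero, the factors
  \<open>b\<^sup>-\<^sup>(\<^sup>a\<^sup>+\<^sup>1\<^sup>) z(x, a)\<close> form a geometric sequence, and \<open>C\<^sub>j\<close> is their \<open>j\<close>-th elementary symmetric
  function. Therefore \<open>\<Sum>j\<le>\<alpha>. C\<^sub>j(N) P\<^sub>\<alpha>\<^sub>-\<^sub>j(N)\<close> does not depend on \<open>N \<ge> n\<close> when \<open>x \<noteq> 0\<close>, and
  changes by the terms of a geometric series when \<open>x = 0\<close>; its limit is \<open>\<omega>\<^sub>\<alpha>(x) + 1\<close>, because
  \<open>P\<^sub>s(N)\<close> grows at most linearly for \<open>s \<ge> 1\<close>.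
\<close>

section \<open>Triangular sums\<close>

text \<open>The bound \<open>N\<close> is exclusive, so that inductions on it can start from an
  empty range of indices.\<close>

definition desc_lists :: "nat \<Rightarrow> nat \<Rightarrow> nat list set" where
  "desc_lists t N = {as. length as = t \<and> sorted_wrt (>) as \<and> set as \<subseteq> {..<N}}"

lemma finite_desc_lists [simp]: "finite (desc_lists t N)"
  by (rule finite_subset[OF _ finite_lists_length_eq[of "{..<N}" t]])
    (auto simp: desc_lists_def)

lemma desc_lists_0 [simp]: "desc_lists 0 N = {[]}"
  by (auto simp: desc_lists_def)

lemma desc_lists_Suc_0 [simp]: "desc_lists (Suc t) 0 = {}"
  by (auto simp: desc_lists_def)

lemma desc_lists_Suc_Suc:
  "desc_lists (Suc t) (Suc N) = desc_lists (Suc t) N \<union> (#) N ` desc_lists t N"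
proof (intro equalityI subsetI)
  fix as assume as: "as \<in> desc_lists (Suc t) (Suc N)"
  then obtain a as' where [simp]: "as = a # as'"
    by (cases as) (auto simp: desc_lists_def)
  show "as \<in> desc_lists (Suc t) N \<union> (#) N ` desc_lists t N"
  proof (cases "a = N")
    case True
    with as show ?thesis by (auto simp: desc_lists_def)
  next
    case False
    with as have "as \<in> desc_lists (Suc t) N" by (fastforce simp: desc_lists_def)
    then show ?thesis by blast
  qed
qed (auto simp: desc_lists_def less_Suc_eq)

lemma sum_desc_lists_Suc_Suc:
  "(\<Sum>as\<in>desc_lists (Suc t) (Suc N). \<phi> as :: real) =
     (\<Sum>as\<in>desc_lists (Suc t) N. \<phi> as) + (\<Sum>as\<in>desc_lists t N. \<phi> (N # as))"
proof -
  have "desc_lists (Suc t) N \<inter> (#) N ` desc_lists t N = {}"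
    by (auto simp: desc_lists_def)
  then have "(\<Sum>as\<in>desc_lists (Suc t) (Suc N). \<phi> as) =
      (\<Sum>as\<in>desc_lists (Suc t) N. \<phi> as) + sum \<phi> ((#) N ` desc_lists t N)"
    unfolding desc_lists_Suc_Suc by (intro sum.union_disjoint) auto
  also have "sum \<phi> ((#) N ` desc_lists t N) = (\<Sum>as\<in>desc_lists t N. \<phi> (N # as))"
    by (subst sum.reindex) (auto simp: inj_on_def)
  finally show ?thesis .
qed

text \<open>The weight \<open>w\<close> sits on the smallest index. Weight 1 gives the entries of
  \<open>T_vec\<close>, weight \<open>bw b x\<close> those of \<open>Tt_vec\<close>, so one
  recursion serves both. The empty tuple has no smallest index and gets weight 1.\<close>

definition tri :: "(nat \<Rightarrow> real) \<Rightarrow> (nat \<Rightarrow> real) \<Rightarrow> nat \<Rightarrow> nat \<Rightarrow> real" where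
  "tri g w t N = (\<Sum>as\<in>desc_lists t N.
     (if t = 0 then 1 else w (as ! (t - 1))) * (\<Prod>i<t. g (as ! i)))"

lemma tri_0 [simp]: "tri g w 0 N = 1"
  by (simp add: tri_def)

lemma tri_Suc_0 [simp]: "tri g w (Suc t) 0 = 0"
  by (simp add: tri_def)

text \<open>Either \<open>N\<close> is the largest index or it does not occur. It is also the
  smallest index only in tuples of length 1, hence \<open>w N\<close> only for
  \<open>t = 0\<close>.\<close>

lemma tri_Suc_Suc:
  "tri g w (Suc t) (Suc N) =
     tri g w (Suc t) N + (if t = 0 then w N else 1) * g N * tri g w t N"
proof -
  have "(\<Sum>as\<in>desc_lists t N. w ((N # as) ! t) * (\<Prod>i<Suc t. g ((N # as) ! i))) =
      (if t = 0 then w N else 1) * g N * tri g w t N"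
    by (cases t) (simp_all add: tri_def prod.lessThan_Suc_shift sum_distrib_left mult_ac
        del: prod.lessThan_Suc)
  then show ?thesis
    unfolding tri_def[of g w "Suc t"] by (simp add: sum_desc_lists_Suc_Suc)
qed

text \<open>There are too few indices below \<open>N\<close>. This matches the accumulators of the
  algorithm, which start at 0.\<close>

lemma tri_eq_0: "N \<le> t \<Longrightarrow> tri g w (Suc t) N = 0"
proof (induction N arbitrary: t)
  case (Suc N)
  then obtain u where "t = Suc u" "N \<le> u" by (auto dest: Suc_le_D)
  with Suc.IH show ?case by (simp add: tri_Suc_Suc)
qed simp

lemma tri_sum_eq:
  "1 \<le> n \<Longrightarrow> tri_sum 0 (n - 1) t \<phi> = (\<Sum>as\<in>desc_lists t n. \<phi> as)"
proof -
  assume "1 \<le> n"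
  then have "{0..n - 1} = {..<n}" by auto
  then show ?thesis by (simp add: tri_sum_def desc_lists_def)
qed

abbreviation zg :: "nat \<Rightarrow> real \<Rightarrow> nat \<Rightarrow> real" where
  "zg b x a \<equiv> 1 / real b ^ (a + 1) * z b x a"

abbreviation bw :: "nat \<Rightarrow> real \<Rightarrow> nat \<Rightarrow> real" where
  "bw b x a \<equiv> real b ^ a * of_bool (int a \<le> beta b x - 1)"

lemma T_entry_eq: "1 \<le> n \<Longrightarrow> T_entry b n x t = tri (zg b x) (\<lambda>_. 1) t n"
  unfolding T_entry_def tri_def by (subst tri_sum_eq) simp_all

lemma Tt_entry_eq: "1 \<le> n \<Longrightarrow> 1 \<le> t \<Longrightarrow> Tt_entry b n x t = tri (zg b x) (bw b x) t n"
  unfolding Tt_entry_def tri_def by (subst tri_sum_eq) simp_all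

section \<open>Runs of the programs\<close>

lemma run_Nil [simp]: "run g [] s = s"
  by (simp add: run_def)

lemma run_Cons [simp]: "run g (i # p) s = run g p (exec g i s)"
  by (simp add: run_def)

lemma run_append [simp]: "run g (p @ q) s = run g q (run g p s)"
  by (simp add: run_def)

fun dest :: "'f instr \<Rightarrow> reg" where
  "dest (Const d c) = d"
| "dest (Add d p q) = d"
| "dest (Sub d p q) = d"
| "dest (Mul d p q) = d"
| "dest (Div d p q) = d"
| "dest (Eval d f a) = d"

lemma run_unchanged: "R \<notin> dest ` set p \<Longrightarrow> run g p s R = s R"
proof (induction p arbitrary: s)
  case (Cons i p)
  then show ?case by (cases i) auto
qed simp

lemma dest_alg_A: "dest ` set (alg_A S f n r) \<subseteq> insert Tmp (range S)"
  by (auto simp: alg_A_def)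

text \<open>
  The update of \<open>S (r - t)\<close> in round \<open>a\<close> admits the new largest index \<open>a + t\<close>, and by then
  \<open>S (r - t + 1)\<close> already accounts for all indices smaller than \<open>a + t\<close>.
\<close>

lemma run_alg_A:
  fixes X :: "nat \<Rightarrow> nat \<Rightarrow> real"
  assumes S: "inj S" "Tmp \<notin> range S" and r: "1 \<le> r"
    and X0: "\<And>N. X 0 N = 1" and X_zero: "\<And>t N. N \<le> t \<Longrightarrow> X (Suc t) N = 0"
    and X_Suc: "\<And>t N. t < r \<Longrightarrow> X (Suc t) (Suc N) = X (Suc t) N + X t N * g (f (r - t)) N"
    and t: "t < r"
  shows "run g (alg_A S f n r) s (S (r - t)) = X (Suc t) n"
proof -
  have S_eq [simp]: "S i = S j \<longleftrightarrow> i = j" for i j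
    using S(1) by (auto dest: injD)
  have S_Tmp [simp]: "S i \<noteq> Tmp" "Tmp \<noteq> S i" for i
    using S(2) by (metis rangeI)+
  define init where "init = map (\<lambda>t. Const (S t) 0 :: 'a instr) [1..<r + 1]"
  define upd where "upd = (\<lambda>a t. [Eval Tmp (f (r - t)) (a + t),
         Mul Tmp (S (r - t + 1)) Tmp, Add (S (r - t)) (S (r - t)) Tmp])"
  define body where "body = (\<lambda>a. [Eval Tmp (f r) a, Add (S r) (S r) Tmp] @
       concat (map (upd a) [1..<min r (n - a)]))"
  have init: "run g init s (S i) = 0" if "i \<in> {1..r}" for s i
  proof -
    have "run g (map (\<lambda>t. Const (S t) 0 :: 'a instr) xs) s (S i) =
        (if i \<in> set xs then 0 else s (S i))" for xs s
      by (induction xs arbitrary: s) auto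
    with that show ?thesis by (simp add: init_def)
  qed
  \<comment> \<open>Invariant within round \<open>a\<close>: accumulator \<open>r - t\<close> covers
    the indices below \<open>a + t\<close> before its update and also \<open>a + t\<close> after it.
    The minimum with \<open>n\<close> describes the accumulators that have already used all
    indices.\<close>
  have inner: "run g (concat (map (upd a) [1..<m])) s (S (r - t)) =
      X (Suc t) (min (if t < m then a + t + 1 else a + t) n)"
    if s: "\<And>t. t < r \<Longrightarrow> s (S (r - t)) = X (Suc t) (min (if t < 1 then a + t + 1 else a + t) n)"
      and m: "1 \<le> m" "m \<le> min r (n - a)" and t: "t < r" for a s t m
    using m t
  proof (induction m arbitrary: t rule: nat_induct_at_least)
    case base
    then show ?case using s[of t] by simp
  next
    case (Suc m)
    let ?s = "run g (concat (map (upd a) [1..<m])) s"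
    have IH: "?s (S (r - t)) = X (Suc t) (min (if t < m then a + t + 1 else a + t) n)"
      if "t < r" for t
      using Suc that by simp
    have run_Suc: "run g (concat (map (upd a) [1..<Suc m])) s = run g (upd a m) ?s"
      using Suc.hyps by simp
    show ?case
    proof (cases "t = m")
      case True
      \<comment> \<open>This accumulator was updated earlier in the same round, so it already covers
        all indices below \<open>a + m\<close>, as the recursion for the new index
        \<open>a + m\<close> requires.\<close>
      have "?s (S (Suc (r - m))) = X m (a + m)"
        using IH[of "m - 1"] Suc.prems Suc.hyps by (cases m) (simp_all add: Suc_diff_Suc)
      then show ?thesis
        using True Suc.prems Suc.hyps IH[of m] X_Suc[of m "a + m"] unfolding run_Suc
        by (simp add: upd_def)
    next
      case False
      then have "r - t \<noteq> r - m" using Suc.prems by auto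
      with False show ?thesis using IH[OF Suc.prems(2)] unfolding run_Suc
        by (auto simp: upd_def)
    qed
  qed
  \<comment> \<open>The accumulators run staggered: number \<open>r - t\<close> is ahead of number
    \<open>r\<close> by \<open>t\<close> indices until all indices are used up.\<close>
  have outer: "run g (init @ concat (map body [0..<m])) s (S (r - t)) = X (Suc t) (min (m + t) n)"
    if "m \<le> n" "t < r" for m t
    using that
  proof (induction m arbitrary: t)
    case 0
    then show ?case by (simp add: init X_zero)
  next
    case (Suc m)
    let ?s = "run g (init @ concat (map body [0..<m])) s"
    let ?s' = "run g [Eval Tmp (f r) m, Add (S r) (S r) Tmp] ?s"
    have s': "?s' (S (r - t)) = X (Suc t) (min (if t < 1 then m + t + 1 else m + t) n)"
      if "t < r" for t
    proof (cases "t = 0")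
      case True
      then show ?thesis using Suc.IH[of 0] Suc.prems r X0 X_Suc[of 0 m] by simp
    next
      case False
      then have "r - t \<noteq> r" using that by auto
      with False show ?thesis using Suc.IH[OF _ that] Suc.prems by simp
    qed
    have "run g (init @ concat (map body [0..<Suc m])) s (S (r - t)) =
        run g (concat (map (upd m) [1..<min r (n - m)])) ?s' (S (r - t))"
      by (simp add: body_def)
    also have "\<dots> =
        X (Suc t) (min (if t < min r (n - m) then m + t + 1 else m + t) n)"
      by (rule inner[OF s']) (use Suc.prems r in auto)
    \<comment> \<open>If \<open>t < r\<close> but there is no update number \<open>t\<close>, then
      \<open>m + t \<ge> n\<close> and both minima are \<open>n\<close>.\<close>
    also have "min (if t < min r (n - m) then m + t + 1 else m + t) n = min (Suc m + t) n"
      using Suc.prems by auto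
    finally show ?case .
  qed
  have "alg_A S f n r = init @ concat (map body [0..<n])"
    unfolding alg_A_def init_def body_def upd_def by simp
  with outer[of n t] t show ?thesis by simp
qed

section \<open>The accumulators of the two runs\<close>

lemma run_prog_T:
  assumes "2 \<le> \<alpha>" "1 \<le> n" "t \<in> {1..<\<alpha>}"
  shows "run (g_val \<alpha> b x) (prog_T \<alpha> n) s (RegS t) = T_entry b n x (\<alpha> - t)"
proof -
  have "run (g_val \<alpha> b x) (alg_A RegS G n (\<alpha> - 1)) s (RegS (\<alpha> - 1 - (\<alpha> - 1 - t))) =
      tri (zg b x) (\<lambda>_. 1) (Suc (\<alpha> - 1 - t)) n"
    by (rule run_alg_A) (use assms in \<open>auto simp: inj_def tri_eq_0 tri_Suc_Suc\<close>)
  then show ?thesis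
    using assms by (simp add: prog_T_def T_entry_eq Suc_diff_Suc)
qed

text \<open>Only the function \<open>Gt \<alpha>\<close> carries the bracket, and it feeds only the
  accumulator of 1-tuples, whose index stays the smallest one in all longer tuples; hence the weight
  \<open>bw b x\<close>.\<close>

lemma run_prog_Tt:
  assumes "2 \<le> \<alpha>" "1 \<le> n" "t \<in> {1..\<alpha>}"
  shows "run (g_val \<alpha> b x) (prog_Tt \<alpha> n) s (RegSt t) = Tt_entry b n x (\<alpha> + 1 - t)"
proof -
  have "run (g_val \<alpha> b x) (alg_A RegSt Gt n \<alpha>) s (RegSt (\<alpha> - (\<alpha> - t))) =
      tri (zg b x) (bw b x) (Suc (\<alpha> - t)) n"
    by (rule run_alg_A) (use assms in \<open>auto simp: inj_def tri_eq_0 tri_Suc_Suc\<close>)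
  then show ?thesis
    using assms by (simp add: prog_Tt_def Tt_entry_eq Suc_diff_le)
qed

lemma run_T_vec:
  assumes "2 \<le> \<alpha>" "1 \<le> n"
  shows "map (\<lambda>t. run (g_val \<alpha> b x) (prog_T \<alpha> n) s (RegS t)) [1..<\<alpha>] = T_vec \<alpha> b n x"
  by (rule nth_equalityI) (use assms in \<open>auto simp: T_vec_def run_prog_T rev_nth Suc_diff_Suc simp del: upt_Suc\<close>)

lemma run_Tt_vec:
  assumes "2 \<le> \<alpha>" "1 \<le> n"
  shows "map (\<lambda>t. run (g_val \<alpha> b x) (prog_Tt \<alpha> n) s (RegSt t)) [1..<\<alpha> + 1] = Tt_vec \<alpha> b n x"
  by (rule nth_equalityI) (use assms in \<open>auto simp: Tt_vec_def run_prog_Tt rev_nth Suc_diff_Suc simp del: upt_Suc\<close>)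

section \<open>Coefficients and their combination with the triangular sums\<close>

lemma C_entry_0 [simp]: "C_entry b n 0 = 1"
  by (simp add: C_entry_def)

lemma C_entry_Suc:
  "C_entry b n (Suc t) =
     C_entry b n t * ((real b - 1) / (real b ^ Suc t - 1) * (1 / real b ^ n))"
  by (simp add: C_entry_def power_add del: power_Suc)

lemma run_prog_C:
  assumes b: "s Base = real b" and t: "t < \<alpha>"
  shows "run g (prog_C \<alpha> n) s (RegC t) = C_entry b n t"
    and "run g (prog_C \<alpha> n) s (RegCbar t) = Cbar_entry b n t"
    and "run g (prog_C \<alpha> n) s One = 1"
proof -
  define body where "body = (\<lambda>t. [Mul PowBase PowBase Base, Sub Tmp PowBase One,
        Div Tmp BaseMinusOne Tmp, Mul Tmp Tmp InvBaseN,
        Mul (RegC t) (RegC (t - 1)) Tmp, Add (RegCbar t) (RegCbar (t - 1)) (RegC t)] :: fname instr list)"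
  define s0 where "s0 = run g ([Const One 1, Const InvBaseN 1] @
     replicate n (Div InvBaseN InvBaseN Base) @
     [Sub BaseMinusOne Base One, Const PowBase 1, Const (RegC 0) 1, Const (RegCbar 0) 1]) s"
  have "run g (replicate n (Div InvBaseN InvBaseN Base)) s =
      s(InvBaseN := s InvBaseN / s Base ^ n)" for s
    by (induction n arbitrary: s) (auto simp: fun_eq_iff)
  then have s0: "s0 One = 1" "s0 Base = real b" "s0 BaseMinusOne = real b - 1" "s0 PowBase = 1"
      "s0 (RegC 0) = 1" "s0 (RegCbar 0) = 1" "s0 InvBaseN = 1 / real b ^ n"
    using b by (simp_all add: s0_def)
  \<comment> \<open>Invariant after \<open>m\<close> rounds. Since \<open>PowBase\<close> is then
    \<open>b ^ m\<close>, the next round computes the factor in \<open>C_entry_Suc\<close>.\<close>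
  have loop: "s' One = 1 \<and> s' Base = real b \<and> s' BaseMinusOne = real b - 1 \<and>
      s' InvBaseN = 1 / real b ^ n \<and> s' PowBase = real b ^ m \<and>
      (\<forall>t\<le>m. s' (RegC t) = C_entry b n t \<and> s' (RegCbar t) = Cbar_entry b n t)"
    if "s' = run g (concat (map body [1..<Suc m])) s0" for m s'
    using that
  proof (induction m arbitrary: s')
    case 0
    then show ?case using s0 by (simp add: Cbar_entry_def)
  next
    case (Suc m)
    let ?s = "run g (concat (map body [1..<Suc m])) s0"
    have "s' = run g (body (Suc m)) ?s" using Suc.prems by simp
    then show ?case
      using Suc.IH[OF refl]
      by (auto simp: body_def Cbar_entry_def C_entry_Suc le_Suc_eq mult_ac)
  qed
  have run: "run g (prog_C \<alpha> n) s = run g (concat (map body [1..<Suc (\<alpha> - 1)])) s0"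
    using t by (simp add: prog_C_def body_def s0_def)
  show "run g (prog_C \<alpha> n) s (RegC t) = C_entry b n t"
    and "run g (prog_C \<alpha> n) s (RegCbar t) = Cbar_entry b n t"
    and "run g (prog_C \<alpha> n) s One = 1"
    using loop[OF run] t by auto
qed

lemma run_accumulate:
  assumes "\<And>t. p t \<notin> {Out, Tmp} \<and> q t \<notin> {Out, Tmp}"
  shows "run g (concat (map (\<lambda>t. [Mul Tmp (p t) (q t), Add Out Out Tmp]) ts)) s Out =
     s Out + (\<Sum>t\<leftarrow>ts. s (p t) * s (q t))"
proof (induction ts arbitrary: s)
  case (Cons t ts)
  have "p t' \<noteq> Out" "p t' \<noteq> Tmp" "q t' \<noteq> Out" "q t' \<noteq> Tmp" for t'
    using assms[of t'] by auto
  then show ?case by (simp add: Cons.IH)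
qed simp

text \<open>Listing one vector by decreasing subscript turns the dot product into a
  convolution.\<close>

lemma dot_map_rev_upt:
  "dot (map f [0..<m]) (map g (rev [1..<Suc m])) = (\<Sum>j<m. f j * g (m - j))"
  unfolding dot_def sum_list_sum_nth
  by (simp add: rev_nth lessThan_atLeast0 Suc_diff_Suc del: upt_Suc)

lemma dot_Cbar_T:
  assumes "1 \<le> \<alpha>"
  shows "dot (take (\<alpha> - 1) (Cbar_vec \<alpha> b n)) (T_vec \<alpha> b n x) =
    (\<Sum>j<\<alpha> - 1. Cbar_entry b n j * T_entry b n x (\<alpha> - 1 - j))"
  using dot_map_rev_upt[of "Cbar_entry b n" "\<alpha> - 1" "T_entry b n x"] assms
  by (simp add: Cbar_vec_def T_vec_def take_map)

lemma dot_C_Tt: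
  "dot (C_vec \<alpha> b n) (Tt_vec \<alpha> b n x) = (\<Sum>j<\<alpha>. C_entry b n j * Tt_entry b n x (\<alpha> - j))"
  using dot_map_rev_upt[of "C_entry b n" \<alpha> "Tt_entry b n x"]
  by (simp add: C_vec_def Tt_vec_def)

text \<open>Apart from \<open>Tmp\<close>, the stages write to disjoint sets of registers, so the
  result of each survives until it is combined.\<close>

lemma run_omega_prog_pos:
  assumes \<alpha>: "2 \<le> \<alpha>" and n: "1 \<le> n" and v: "0 < v" and s: "s Base = real b"
  shows "run (g_val \<alpha> b x) (omega_prog \<alpha> n v) s Out =
    dot (take (\<alpha> - 1) (Cbar_vec \<alpha> b n)) (T_vec \<alpha> b n x)
    + (Cbar_entry b n (\<alpha> - 1) - 1) + dot (C_vec \<alpha> b n) (Tt_vec \<alpha> b n x)"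
proof -
  let ?run = "run (g_val \<alpha> b x)"
  define s1 where "s1 = ?run (prog_T \<alpha> n) s"
  define s2 where "s2 = ?run (prog_Tt \<alpha> n) s1"
  define s3 where "s3 = ?run (prog_C \<alpha> n) s2"
  have pT: "R \<noteq> Tmp \<Longrightarrow> R \<notin> range RegS \<Longrightarrow> s1 R = s R" for R
    unfolding s1_def prog_T_def using dest_alg_A by (intro run_unchanged) fast
  have pTt: "R \<noteq> Tmp \<Longrightarrow> R \<notin> range RegSt \<Longrightarrow> s2 R = s1 R" for R
    unfolding s2_def prog_Tt_def using dest_alg_A by (intro run_unchanged) fast
  have pC: "R \<in> range RegS \<union> range RegSt \<Longrightarrow> s3 R = s2 R" for R
    unfolding s3_def by (intro run_unchanged) (auto simp: prog_C_def)
  have "s2 Base = real b"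
    using s by (subst pTt, simp, blast, subst pT) auto
  note C = run_prog_C[where g = "g_val \<alpha> b x", where n = n and s = s2 and \<alpha> = \<alpha>, OF this, folded s3_def]
  have S: "s3 (RegS (t + 1)) = T_entry b n x (\<alpha> - 1 - t)" if "t < \<alpha> - 1" for t
    using that \<alpha> n by (subst pC, simp, subst pTt, simp, blast)
      (simp add: s1_def run_prog_T)
  have St: "s3 (RegSt (t + 1)) = Tt_entry b n x (\<alpha> - t)" if "t < \<alpha>" for t
    using that \<alpha> n by (subst pC, simp) (simp add: s2_def run_prog_Tt)
  \<comment> \<open>The state after the first instruction of \<open>prog_combine\<close>.\<close>
  let ?s4 = "s3(Out := s3 (RegCbar (\<alpha> - 1)) - s3 One)"
  let ?p = "concat (map (\<lambda>t. [Mul Tmp (RegCbar t) (RegS (t + 1)), Add Out Out Tmp]) [0..<\<alpha> - 1])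
    :: fname instr list"
  have keep: "R \<notin> {Tmp, Out} \<Longrightarrow> ?run ?p ?s4 R = s3 R" for R
    by (subst run_unchanged) auto
  have "?run (omega_prog \<alpha> n v) s Out = ?run (prog_combine \<alpha>) s3 Out"
    using v by (simp add: omega_prog_def s1_def s2_def s3_def)
  also have "\<dots> = ?run ?p ?s4 Out + (\<Sum>t\<leftarrow>[0..<\<alpha>]. s3 (RegC t) * s3 (RegSt (t + 1)))"
    using keep by (simp add: prog_combine_def run_accumulate)
  also have "?run ?p ?s4 Out = s3 (RegCbar (\<alpha> - 1)) - s3 One +
      (\<Sum>t\<leftarrow>[0..<\<alpha> - 1]. s3 (RegCbar t) * s3 (RegS (t + 1)))"
    by (subst run_accumulate) simp_all
  also have "(\<Sum>t\<leftarrow>[0..<\<alpha> - 1]. s3 (RegCbar t) * s3 (RegS (t + 1))) =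
      (\<Sum>j<\<alpha> - 1. Cbar_entry b n j * T_entry b n x (\<alpha> - 1 - j))"
    using S C(2) by (simp add: interv_sum_list_conv_sum_set_nat lessThan_atLeast0)
  also have "(\<Sum>t\<leftarrow>[0..<\<alpha>]. s3 (RegC t) * s3 (RegSt (t + 1))) =
      (\<Sum>j<\<alpha>. C_entry b n j * Tt_entry b n x (\<alpha> - j))"
    using St C(1) by (simp add: interv_sum_list_conv_sum_set_nat lessThan_atLeast0)
  also have "s3 (RegCbar (\<alpha> - 1)) - s3 One = Cbar_entry b n (\<alpha> - 1) - 1"
    using C(2,3)[of "\<alpha> - 1"] \<alpha> by simp
  finally show ?thesis
    using \<alpha> by (subst dot_Cbar_T) (simp_all add: dot_C_Tt)
qed

lemma run_prog_zero:
  assumes \<alpha>: "1 \<le> \<alpha>" and s: "s Base = real b"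
  shows "run g (prog_zero \<alpha>) s Out =
    (\<Sum>r=1..\<alpha> - 1. \<Prod>i=1..r. (real b - 1) / (real b ^ i - 1))
      + (real b - 1) / (real b ^ \<alpha> - real b) * (\<Prod>i=1..\<alpha> - 1. (real b - 1) / (real b ^ i - 1))"
proof -
  define body where "body = (\<lambda>r :: nat. [Mul PowBase PowBase Base, Sub Tmp PowBase One,
        Div Tmp BaseMinusOne Tmp, Mul ProdReg ProdReg Tmp, Add Out Out ProdReg] :: fname instr list)"
  define s0 where "s0 = run g [Const One 1, Sub BaseMinusOne Base One, Const PowBase 1,
    Const ProdReg 1, Const Out 0] s"
  have s0: "s0 One = 1" "s0 Base = real b" "s0 BaseMinusOne = real b - 1" "s0 PowBase = 1"
      "s0 ProdReg = 1" "s0 Out = 0"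
    using s by (simp_all add: s0_def)
  have loop: "s' One = 1 \<and> s' Base = real b \<and> s' BaseMinusOne = real b - 1 \<and>
      s' PowBase = real b ^ m \<and> s' ProdReg = (\<Prod>i=1..m. (real b - 1) / (real b ^ i - 1)) \<and>
      s' Out = (\<Sum>r=1..m. \<Prod>i=1..r. (real b - 1) / (real b ^ i - 1))"
    if "s' = run g (concat (map body [1..<Suc m])) s0" for m s'
    using that
  proof (induction m arbitrary: s')
    case 0
    then show ?case using s0 by simp
  next
    case (Suc m)
    let ?s = "run g (concat (map body [1..<Suc m])) s0"
    have "s' = run g (body (Suc m)) ?s" using Suc.prems by simp
    then show ?case
      using Suc.IH[OF refl] by (simp add: body_def mult_ac)
  qed
  \<comment> \<open>The loop leaves \<open>b ^ (\<alpha> - 1)\<close> in \<open>PowBase\<close>; the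
    next multiplication makes it \<open>b ^ \<alpha>\<close>.\<close>
  have "run g (prog_zero \<alpha>) s = run g [Mul PowBase PowBase Base, Sub Tmp PowBase Base,
      Div Tmp BaseMinusOne Tmp, Mul Tmp Tmp ProdReg, Add Out Out Tmp]
      (run g (concat (map body [1..<Suc (\<alpha> - 1)])) s0)"
    using \<alpha> by (simp add: prog_zero_def body_def s0_def)
  then show ?thesis
    using loop[OF refl, of "\<alpha> - 1"] \<alpha> power_Suc2[of "real b" "\<alpha> - 1"] by simp
qed

section \<open>Operation counts\<close>

lemma length_alg_A: "length (alg_A S f n r) \<le> r + 5 * n + 3 * (n * r)"
proof -
  have three: "m + (m + m) - Suc (Suc (Suc 0)) = 3 * (m - Suc 0)" for m
    by (cases m) simp_all
  have "length (alg_A S f n r) = r + (\<Sum>a<n. 2 + 3 * (min r (n - a) - 1))"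
    by (auto simp: alg_A_def length_concat comp_def sum_list_triv interv_sum_list_conv_sum_set_nat
        lessThan_atLeast0 three intro!: sum.cong)
  also have "(\<Sum>a<n. 2 + 3 * (min r (n - a) - 1)) \<le> (\<Sum>a<n. 2 + 3 * r)"
    by (intro sum_mono) auto
  finally show ?thesis by (simp add: algebra_simps)
qed

text \<open>Adding up the bounds of all parts, of both branches at once, gives at most
  \<open>51 * \<alpha> * n\<close>, because 1, \<alpha> and \<open>n\<close> are all at most
  \<open>\<alpha> * n\<close>.\<close>

lemma length_omega_prog:
  assumes \<alpha>: "2 \<le> \<alpha>" and n: "1 \<le> n"
  shows "length (omega_prog \<alpha> n v) \<le> 60 * \<alpha> * n"
proof -
  have le: "1 \<le> \<alpha> * n" "\<alpha> \<le> \<alpha> * n" "n \<le> \<alpha> * n"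
    using assms by (auto simp: Suc_le_eq)
  have "length (prog_zero \<alpha>) \<le> 10 + 5 * \<alpha>"
    by (simp add: prog_zero_def length_concat comp_def sum_list_triv)
  moreover have "length (prog_T \<alpha> n) \<le> \<alpha> + 5 * n + 3 * (n * \<alpha>)"
    unfolding prog_T_def by (rule order.trans[OF length_alg_A]) (simp add: add_mono)
  moreover have "length (prog_Tt \<alpha> n) \<le> \<alpha> + 5 * n + 3 * (n * \<alpha>)"
    unfolding prog_Tt_def by (rule length_alg_A)
  moreover have "length (prog_C \<alpha> n) \<le> 6 + n + 6 * \<alpha>"
    by (simp add: prog_C_def length_concat comp_def sum_list_triv)
  moreover have "length (prog_combine \<alpha>) \<le> 1 + 4 * \<alpha>"
    by (simp add: prog_combine_def length_concat comp_def sum_list_triv)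
  moreover have "length (omega_prog \<alpha> n v) \<le> length (prog_zero \<alpha>) + length (prog_T \<alpha> n) +
      length (prog_Tt \<alpha> n) + length (prog_C \<alpha> n) + length (prog_combine \<alpha>)"
    by (simp add: omega_prog_def)
  ultimately show ?thesis
    using le unfolding mult.commute[of n \<alpha>] mult.assoc by linarith
qed

section \<open>Partial sums of the Walsh series\<close>

text \<open>The \<open>P\<^sub>\<alpha>(N)\<close> of the overview, defined by their recursion with
  an arbitrary sequence \<zeta> in place of \<open>z b x\<close>. Growth and limits depend only on
  the values of \<zeta>.\<close>

fun wsum :: "real \<Rightarrow> (nat \<Rightarrow> real) \<Rightarrow> nat \<Rightarrow> nat \<Rightarrow> real" where
  "wsum b \<zeta> 0 N = (\<Prod>a<N. 1 + \<zeta> a)"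
| "wsum b \<zeta> (Suc t) 0 = 1"
| "wsum b \<zeta> (Suc t) (Suc N) = wsum b \<zeta> (Suc t) N + \<zeta> N / b ^ Suc N * wsum b \<zeta> t N"

section \<open>Digits and weights when a leading digit is put in front\<close>

lemma kdigit_eq_0: "k < b ^ i \<Longrightarrow> kdigit b k i = 0"
  by (simp add: kdigit_def)

lemma kdigit_eq_0_of_le: "2 \<le> b \<Longrightarrow> k < b ^ N \<Longrightarrow> N \<le> i \<Longrightarrow> kdigit b k i = 0"
  by (rule kdigit_eq_0) (erule less_le_trans, simp add: power_increasing)

lemma kdigit_add:
  assumes "2 \<le> b" "\<kappa> < b" "k < b ^ N"
  shows "kdigit b (\<kappa> * b ^ N + k) i = (if i < N then kdigit b k i else if i = N then \<kappa> else 0)"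
proof -
  consider "i < N" | "i = N" | "N < i" by linarith
  then show ?thesis
  proof cases
    case 1
    \<comment> \<open>After division by \<open>b ^ i\<close> the leading block still contains a
      factor \<open>b\<close>, which vanishes modulo \<open>b\<close>.\<close>
    then obtain d where d: "N = i + Suc d" by (metis less_iff_Suc_add add_Suc_right)
    have "(\<kappa> * b ^ N + k) div b ^ i = \<kappa> * b ^ d * b + k div b ^ i"
    proof -
      have "\<kappa> * b ^ N + k = (\<kappa> * b ^ d * b) * b ^ i + k"
        by (simp add: d power_add mult_ac)
      moreover have "b ^ i \<noteq> 0" using assms(1) by simp
      ultimately show ?thesis by (simp only: div_mult_self3 not_False_eq_True)
    qed
    then show ?thesis using 1 by (simp add: kdigit_def)
  next
    case 2
    then show ?thesis using assms by (simp add: kdigit_def)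
  next
    case 3
    have "\<kappa> * b ^ N + k < Suc \<kappa> * b ^ N" using assms by simp
    also have "\<dots> \<le> b ^ Suc N" using assms by (simp del: mult_Suc)
    finally have "\<kappa> * b ^ N + k < b ^ Suc N" .
    with 3 show ?thesis using kdigit_eq_0_of_le[OF assms(1), of _ "Suc N" i] by simp
  qed
qed

lemma finite_nonzero_digits: "2 \<le> b \<Longrightarrow> finite {i. kdigit b k i \<noteq> 0}"
proof (rule finite_subset)
  assume "2 \<le> b"
  then have "k < b ^ k"
    using power_gt_expt[of b k] by simp
  with \<open>2 \<le> b\<close> show "{i. kdigit b k i \<noteq> 0} \<subseteq> {..<k}"
    by (metis (mono_tags, lifting) kdigit_eq_0_of_le lessThan_iff linorder_not_le mem_Collect_eq subsetI)
qed simp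

lemma sorted_list_of_set_insert_max:
  assumes "finite A" "\<And>a. a \<in> A \<Longrightarrow> a < N"
  shows "sorted_list_of_set (insert N A) = sorted_list_of_set A @ [N :: nat]"
proof -
  have "sorted_list_of_set (insert N A) = insort N (sorted_list_of_set A)"
    using assms by (intro sorted_list_of_set_insert) auto
  also have "\<dots> = sorted_list_of_set A @ [N]"
    using assms by (intro sorted_insort_is_snoc) (auto simp: less_imp_le)
  finally show ?thesis .
qed

lemma nonzero_positions_add:
  assumes "2 \<le> b" "0 < \<kappa>" "\<kappa> < b" "k < b ^ N"
  shows "nonzero_positions b (\<kappa> * b ^ N + k) = N # nonzero_positions b k"
proof -
  have less: "i < N" if "kdigit b k i \<noteq> 0" for i
    using that kdigit_eq_0_of_le[OF assms(1,4)] by (meson not_le)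
  have "{i. kdigit b (\<kappa> * b ^ N + k) i \<noteq> 0} = insert N {i. kdigit b k i \<noteq> 0}"
    using assms less by (auto simp: kdigit_add)
  moreover have "sorted_list_of_set (insert N {i. kdigit b k i \<noteq> 0}) =
      sorted_list_of_set {i. kdigit b k i \<noteq> 0} @ [N]"
    by (rule sorted_list_of_set_insert_max) (use less finite_nonzero_digits assms(1) in auto)
  ultimately show ?thesis
    unfolding nonzero_positions_def by (simp only: rev_append rev_singleton_conv) simp
qed

text \<open>The new leading position takes one of the \<open>Suc \<alpha>\<close> counted places and
  contributes the exponent \<open>N + 1\<close>; the digits of \<open>k\<close> are left with
  \<alpha> places.\<close>

lemma r_weight_Suc_add:
  assumes "2 \<le> b" "0 < \<kappa>" "\<kappa> < b" "k < b ^ N"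
  shows "r_weight (Suc \<alpha>) b (\<kappa> * b ^ N + k) = r_weight \<alpha> b k / real b ^ Suc N"
  using nonzero_positions_add[OF assms] by (simp add: r_weight_def power_add)

lemma r_weight_0 [simp]: "r_weight 0 b k = 1"
  by (simp add: r_weight_def)

lemma r_weight_zero [simp]: "r_weight \<alpha> b 0 = 1"
  by (simp add: r_weight_def nonzero_positions_def kdigit_def)

lemma r_weight_nonneg: "0 \<le> r_weight \<alpha> b k"
  by (simp add: r_weight_def)

section \<open>Walsh functions and their sums over one digit\<close>

lemma wal_eq:
  assumes "2 \<le> b" "k < b ^ N"
  shows "wal b k x =
    exp (2 * of_real pi * \<i> * of_nat (\<Sum>i<N. xdigit b x (i + 1) * kdigit b k i) / of_nat b)"
proof -
  have k: "k < b ^ k"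
    using power_gt_expt[of b k] assms by simp
  \<comment> \<open>Positions in only one of the two ranges carry digit 0, so all
    \<open>k < b ^ N\<close> can share the range below \<open>N\<close>.\<close>
  have "(\<Sum>i\<le>k. xdigit b x (i + 1) * kdigit b k i) = (\<Sum>i<N. xdigit b x (i + 1) * kdigit b k i)"
    by (rule sum.mono_neutral_cong)
      (use kdigit_eq_0_of_le[OF assms(1) k] kdigit_eq_0_of_le[OF assms] in \<open>auto simp: not_less not_le\<close>)
  then show ?thesis by (simp add: wal_def)
qed

lemma exp_eq_cis:
  "exp (2 * of_real pi * \<i> * of_nat m / of_nat b) = cis (2 * pi * real m / real b)"
  by (simp add: cis_conv_exp mult_ac)

lemma wal_add:
  assumes "2 \<le> b" "\<kappa> < b" "k < b ^ N"
  shows "wal b (\<kappa> * b ^ N + k) x =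
    exp (2 * of_real pi * \<i> * of_nat (xdigit b x (Suc N)) / of_nat b) ^ \<kappa> * wal b k x"
proof -
  have "\<kappa> * b ^ N + k < Suc \<kappa> * b ^ N" using assms by simp
  also have "\<dots> \<le> b ^ Suc N" using assms by (simp del: mult_Suc)
  finally have "\<kappa> * b ^ N + k < b ^ Suc N" .
  then have "wal b (\<kappa> * b ^ N + k) x =
      cis (2 * pi * real (\<Sum>i<Suc N. xdigit b x (i + 1) * kdigit b (\<kappa> * b ^ N + k) i) / real b)"
    by (simp only: wal_eq[OF assms(1)] exp_eq_cis)
  also have "(\<Sum>i<Suc N. xdigit b x (i + 1) * kdigit b (\<kappa> * b ^ N + k) i) =
      \<kappa> * xdigit b x (Suc N) + (\<Sum>i<N. xdigit b x (i + 1) * kdigit b k i)" (is "_ = _ + ?d")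
    using assms by (simp add: kdigit_add)
  also have "cis (2 * pi * real (\<kappa> * xdigit b x (Suc N) + ?d) / real b) =
      cis (2 * pi * real (xdigit b x (Suc N)) / real b) ^ \<kappa> * cis (2 * pi * real ?d / real b)"
    unfolding DeMoivre cis_mult by (rule arg_cong[of _ _ cis]) (simp add: add_divide_distrib algebra_simps)
  also have "cis (2 * pi * real ?d / real b) = wal b k x"
    by (simp only: wal_eq[OF assms(1,3)] exp_eq_cis)
  finally show ?thesis
    unfolding exp_eq_cis .
qed

lemma wal_0 [simp]: "wal b 0 x = 1"
  by (simp add: wal_def kdigit_def)

text \<open>Orthogonality of characters: the base of the powers is a \<open>b\<close>-th root of
  unity and equals 1 only if the digit is 0, so the sum is \<open>b\<close> or 0.\<close>

lemma sum_character:
  assumes b: "2 \<le> b"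
  shows "(\<Sum>\<kappa><b. exp (2 * of_real pi * \<i> * of_nat (xdigit b x (Suc a)) / of_nat b) ^ \<kappa>) =
    of_real (1 + z b x a)"
proof (cases "xdigit b x (Suc a) = 0")
  case True
  then show ?thesis using b by (simp add: z_def)
next
  case False
  let ?\<xi> = "xdigit b x (Suc a)"
  let ?q = "cis (2 * pi * real ?\<xi> / real b)"
  have "?\<xi> < b" using b by (simp add: xdigit_def)
  have "?q ^ b = 1"
    using b by (simp add: DeMoivre)
  moreover have "?q \<noteq> 1"
  proof
    assume "?q = 1"
    then have "cos (2 * pi * real ?\<xi> / real b) = 1"
      by (simp add: complex_eq_iff)
    then obtain m :: int where "2 * pi * real ?\<xi> / real b = of_int m * 2 * pi"
      unfolding cos_one_2pi_int by blast
    then have "real ?\<xi> = of_int m * real b"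
      using b by (simp add: field_simps)
    then have "int ?\<xi> = m * int b"
      by (metis of_int_eq_iff of_int_mult of_int_of_nat_eq)
    with \<open>?\<xi> < b\<close> False show False
      by (metis dvd_triv_right int_dvd_int_iff nat_dvd_not_less neq0_conv)
  qed
  ultimately have "(\<Sum>\<kappa><b. ?q ^ \<kappa>) = 0"
    by (simp add: geometric_sum)
  with False show ?thesis by (simp add: z_def exp_eq_cis)
qed

lemma sum_blocks:
  fixes f :: "nat \<Rightarrow> 'a :: comm_monoid_add"
  shows "(\<Sum>k<b ^ Suc N. f k) = (\<Sum>\<kappa><b. \<Sum>k<b ^ N. f (\<kappa> * b ^ N + k))"
proof -
  have "sum f {\<kappa> * b ^ N..<\<kappa> * b ^ N + b ^ N} = (\<Sum>k<b ^ N. f (\<kappa> * b ^ N + k))" for \<kappa>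
    using sum.shift_bounds_nat_ivl[of f 0 "\<kappa> * b ^ N" "b ^ N"]
    by (simp add: lessThan_atLeast0 add.commute)
  then show ?thesis
    using sum.nat_group[of f "b ^ N" b] by simp
qed

lemma sum_r_weight_wal:
  assumes b: "2 \<le> b"
  shows "(\<Sum>k<b ^ N. of_real (r_weight \<alpha> b k) * wal b k x) = of_real (wsum (real b) (z b x) \<alpha> N)"
proof (induction N arbitrary: \<alpha>)
  case 0
  then show ?case by (cases \<alpha>) auto
next
  case (Suc N)
  let ?f = "\<lambda>\<alpha> k. of_real (r_weight \<alpha> b k) * wal b k x :: complex"
  let ?q = "exp (2 * of_real pi * \<i> * of_nat (xdigit b x (Suc N)) / of_nat b) :: complex"
  show ?case
  proof (cases \<alpha>)
    case 0
    \<comment> \<open>The weight is constantly 1, so the block \<open>\<kappa> = 0\<close> behaves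
      like the others and the full character sum \<open>1 + z\<close> appears.\<close>
    have "(\<Sum>k<b ^ Suc N. ?f 0 k) = (\<Sum>\<kappa><b. ?q ^ \<kappa> * (\<Sum>k<b ^ N. ?f 0 k))"
      unfolding sum_blocks using b by (simp add: wal_add sum_distrib_left)
    also have "\<dots> = of_real (1 + z b x N) * of_real (wsum (real b) (z b x) 0 N)"
      unfolding Suc.IH sum_character[OF b, symmetric] by (simp add: sum_distrib_right)
    finally show ?thesis by (simp add: 0 mult_ac)
  next
    case (Suc \<beta>)
    \<comment> \<open>The block \<open>\<kappa> = 0\<close> is split off, since a zero digit does
      not use up a counted position; the remaining characters sum to \<open>z\<close>.\<close>
    have "{..<b} = insert 0 {1..<b}" using b by auto
    have block: "(\<Sum>k<b ^ N. ?f \<alpha> (\<kappa> * b ^ N + k)) =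
        ?q ^ \<kappa> * (of_real (wsum (real b) (z b x) \<beta> N) / of_nat b ^ Suc N)" if "\<kappa> \<in> {1..<b}" for \<kappa>
    proof -
      have "?f \<alpha> (\<kappa> * b ^ N + k) = ?q ^ \<kappa> * (?f \<beta> k / of_nat b ^ Suc N)" if "k < b ^ N" for k
        using \<open>\<kappa> \<in> {1..<b}\<close> that b Suc by (simp add: wal_add r_weight_Suc_add)
      then have "(\<Sum>k<b ^ N. ?f \<alpha> (\<kappa> * b ^ N + k)) = ?q ^ \<kappa> * ((\<Sum>k<b ^ N. ?f \<beta> k) / of_nat b ^ Suc N)"
        by (simp add: sum_distrib_left sum_divide_distrib)
      then show ?thesis unfolding Suc.IH .
    qed
    have q: "(\<Sum>\<kappa>\<in>{1..<b}. ?q ^ \<kappa>) = of_real (z b x N)"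
      using sum_character[OF b, of x N] \<open>{..<b} = insert 0 {1..<b}\<close> by simp
    have "(\<Sum>k<b ^ Suc N. ?f \<alpha> k) = (\<Sum>k<b ^ N. ?f \<alpha> k) +
        (\<Sum>\<kappa>\<in>{1..<b}. \<Sum>k<b ^ N. ?f \<alpha> (\<kappa> * b ^ N + k))"
      unfolding sum_blocks \<open>{..<b} = insert 0 {1..<b}\<close> by simp
    also have "\<dots> = of_real (wsum (real b) (z b x) \<alpha> N) +
        of_real (z b x N) * (of_real (wsum (real b) (z b x) \<beta> N) / of_nat b ^ Suc N)"
      unfolding Suc.IH q[symmetric] sum_distrib_right using block by (intro arg_cong2[of _ _ _ _ "(+)"] refl sum.cong) auto
    finally show ?thesis by (simp add: Suc)
  qed
qed

section \<open>The limit of the partial sums\<close>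

text \<open>Below, \<open>kcoeff b j / b ^ (N * j)\<close> is the \<open>j\<close>-th elementary symmetric function of the numbers
  \<open>(b - 1) / b ^ (a + 1)\<close> with \<open>a \<ge> N\<close>.\<close>

definition kcoeff :: "real \<Rightarrow> nat \<Rightarrow> real" where
  "kcoeff b t = (\<Prod>i=1..t. (b - 1) / (b ^ i - 1))"

lemma kcoeff_0 [simp]: "kcoeff b 0 = 1"
  by (simp add: kcoeff_def)

lemma kcoeff_Suc: "1 < b \<Longrightarrow> kcoeff b (Suc t) * (b ^ Suc t - 1) = kcoeff b t * (b - 1)"
proof -
  assume "1 < b"
  then have "b ^ Suc t \<noteq> 1" using one_less_power[of b "Suc t"] by force
  then show ?thesis by (simp add: kcoeff_def del: power_Suc)
qed

text \<open>The limit of \<open>wsum b \<zeta> t\<close> as predicted at stage \<open>N\<close> if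
  \<zeta> is \<open>b - 1\<close> from there on: \<open>j\<close> of the counted positions lie at
  \<open>N\<close> or beyond, the other \<open>t - j\<close> below. For \<open>j = t\<close> the sum
  over the uncounted lower digits is approximated by its value at stage \<open>N\<close>.\<close>

definition tail_sum :: "real \<Rightarrow> (nat \<Rightarrow> real) \<Rightarrow> nat \<Rightarrow> nat \<Rightarrow> real" where
  "tail_sum b \<zeta> t N = (\<Sum>j\<le>t. kcoeff b j / b ^ (N * j) * wsum b \<zeta> (t - j) N)"

text \<open>Dropping the variable with index \<open>N\<close> from an elementary symmetric function:
  the products that contain it are lost.\<close>

lemma kcoeff_rec:
  assumes "1 < b"
  shows "kcoeff b (Suc j) / b ^ (N * Suc j) - kcoeff b (Suc j) / b ^ (Suc N * Suc j) =
    kcoeff b j / b ^ (Suc N * j) * ((b - 1) / b ^ Suc N)"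
proof -
  have "kcoeff b (Suc j) / b ^ (N * Suc j) - kcoeff b (Suc j) / b ^ (Suc N * Suc j) =
      kcoeff b (Suc j) * (b ^ Suc j - 1) / b ^ (Suc N * Suc j)"
    using assms by (simp add: power_add divide_simps) (simp add: algebra_simps)
  then show ?thesis
    unfolding kcoeff_Suc[OF assms] by (simp add: power_add mult_ac)
qed

text \<open>Position \<open>N\<close> moves from the coefficients into the partial sums, and for
  \<open>j < t\<close> the two recursions cancel. Only \<open>j = t\<close> remains, as
  \<open>wsum b \<zeta> 0\<close> follows a multiplicative recursion.\<close>

lemma tail_sum_Suc:
  assumes b: "1 < b" and \<zeta>: "\<zeta> N = b - 1"
  shows "tail_sum b \<zeta> t (Suc N) = tail_sum b \<zeta> t N +
    kcoeff b t / b ^ (Suc N * t) * (wsum b \<zeta> 0 (Suc N) - wsum b \<zeta> 0 N)"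
proof -
  define c where "c = (\<lambda>N j. kcoeff b j / b ^ (N * j))"
  define X where "X = wsum b \<zeta>"
  have c0: "c N 0 = 1" for N by (simp add: c_def)
  have rec: "c (Suc N) j * ((b - 1) / b ^ Suc N) = c N (Suc j) - c (Suc N) (Suc j)" for j
    unfolding c_def using kcoeff_rec[OF b] by simp
  have step: "c (Suc N) j * X (t - j) (Suc N) = c (Suc N) j * X (t - j) N +
      (c N (Suc j) - c (Suc N) (Suc j)) * X (t - Suc j) N" if "j < t" for j
  proof -
    have "t - j = Suc (t - Suc j)" using that by simp
    then have "X (t - j) (Suc N) = X (t - j) N + (b - 1) / b ^ Suc N * X (t - Suc j) N"
      unfolding X_def using \<zeta> by simp
    then show ?thesis unfolding rec[symmetric] by (simp add: algebra_simps)
  qed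
  have "tail_sum b \<zeta> t (Suc N) = (\<Sum>j<t. c (Suc N) j * X (t - j) (Suc N)) + c (Suc N) t * X 0 (Suc N)"
    by (simp add: tail_sum_def c_def X_def flip: lessThan_Suc_atMost)
  also have "(\<Sum>j<t. c (Suc N) j * X (t - j) (Suc N)) = (\<Sum>j<t. c (Suc N) j * X (t - j) N) +
      (\<Sum>j<t. c N (Suc j) * X (t - Suc j) N) - (\<Sum>j<t. c (Suc N) (Suc j) * X (t - Suc j) N)"
    using step by (simp add: sum.distrib sum_subtractf left_diff_distrib)
  \<comment> \<open>Both index shifts miss the same term \<open>X t N\<close>, because
    \<open>c\<close> is 1 at \<open>j = 0\<close> for either stage; these terms cancel.\<close>
  also have "(\<Sum>j<t. c N (Suc j) * X (t - Suc j) N) = (\<Sum>j<Suc t. c N j * X (t - j) N) - X t N"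
    unfolding sum.lessThan_Suc_shift[of _ t] by (simp add: c0)
  also have "(\<Sum>j<t. c (Suc N) (Suc j) * X (t - Suc j) N) =
      (\<Sum>j<Suc t. c (Suc N) j * X (t - j) N) - X t N"
    unfolding sum.lessThan_Suc_shift[of _ t] by (simp add: c0)
  finally show ?thesis
    by (simp add: tail_sum_def c_def X_def algebra_simps flip: lessThan_Suc_atMost)
qed

section \<open>Growth and limits of the partial sums\<close>

lemma abs_wsum_0_le:
  assumes "\<And>a. \<zeta> a = b - 1 \<or> \<zeta> a = - 1" "1 \<le> b"
  shows "\<bar>wsum b \<zeta> 0 N\<bar> \<le> b ^ N"
proof -
  have "\<bar>\<Prod>a<N. 1 + \<zeta> a\<bar> = (\<Prod>a<N. \<bar>1 + \<zeta> a\<bar>)" by (rule abs_prod)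
  also have "\<dots> \<le> (\<Prod>a<N. b)"
  proof (rule prod_mono)
    fix a
    show "0 \<le> \<bar>1 + \<zeta> a\<bar> \<and> \<bar>1 + \<zeta> a\<bar> \<le> b"
      using assms(1)[of a] assms(2) by auto
  qed
  finally show ?thesis by simp
qed

text \<open>Each step of the recursion changes the value by at most 1.\<close>

lemma abs_wsum_Suc_le:
  assumes \<zeta>: "\<And>a. \<zeta> a = b - 1 \<or> \<zeta> a = - 1" and b: "2 \<le> b"
  shows "\<bar>wsum b \<zeta> (Suc t) N\<bar> \<le> real N + 1"
proof (induction N arbitrary: t)
  case (Suc N)
  have "\<bar>\<zeta> N\<bar> \<le> b - 1"
    using \<zeta>[of N] b by auto
  \<comment> \<open>Bernoulli's inequality lets the denominator \<open>b ^ Suc N\<close> absorb the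
    linear bound for the lower index.\<close>
  have "1 + real (Suc N) * (b - 1) \<le> (1 + (b - 1)) ^ Suc N"
    by (rule Bernoulli_inequality) (use b in simp)
  then have "(b - 1) * (real N + 1) \<le> b ^ Suc N" by (simp add: mult.commute algebra_simps)
  have "(b - 1) * \<bar>wsum b \<zeta> t N\<bar> \<le> b ^ Suc N"
  proof (cases t)
    case 0
    have "(b - 1) * \<bar>wsum b \<zeta> 0 N\<bar> \<le> b * b ^ N"
      using abs_wsum_0_le[where N = N, OF \<zeta>] b by (intro mult_mono) auto
    with 0 show ?thesis by simp
  next
    case (Suc u)
    have "(b - 1) * \<bar>wsum b \<zeta> t N\<bar> \<le> (b - 1) * (real N + 1)"
      unfolding Suc using Suc.IH b by (intro mult_left_mono) auto
    with \<open>(b - 1) * (real N + 1) \<le> b ^ Suc N\<close> show ?thesis by linarith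
  qed
  moreover have "\<bar>\<zeta> N\<bar> * \<bar>wsum b \<zeta> t N\<bar> \<le> (b - 1) * \<bar>wsum b \<zeta> t N\<bar>"
    using \<open>\<bar>\<zeta> N\<bar> \<le> b - 1\<close> by (intro mult_right_mono) auto
  ultimately have "\<bar>\<zeta> N / b ^ Suc N * wsum b \<zeta> t N\<bar> \<le> 1"
    using b by (simp add: abs_mult divide_simps)
  with Suc.IH[of t] show ?case
    unfolding wsum.simps(3) by linarith
qed simp

lemma tendsto_n_over_power:
  assumes "1 < (b :: real)"
  shows "(\<lambda>N. (real N + 1) / b ^ N) \<longlonglongrightarrow> 0"
proof -
  have "(\<lambda>N. real N * (1 / b) ^ N + (1 / b) ^ N) \<longlonglongrightarrow> 0 + 0"
    using assms by (intro tendsto_add powser_times_n_limit_0 LIMSEQ_power_zero) simp_all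
  then show ?thesis by (simp add: add_divide_distrib power_divide)
qed

text \<open>The summand \<open>j = 0\<close> is \<open>wsum b \<zeta> t\<close> itself. For
  \<open>0 < j < t\<close> a power of \<open>b ^ N\<close> divides a term of linear growth. For
  \<open>j = t\<close> the numerator can be as large as \<open>b ^ N\<close>, which
  \<open>b ^ (N * t)\<close> beats because \<open>t \<ge> 2\<close>.\<close>

lemma tail_sum_minus_wsum:
  assumes \<zeta>: "\<And>a. \<zeta> a = b - 1 \<or> \<zeta> a = - 1" and b: "2 \<le> b" and t: "2 \<le> t"
  shows "(\<lambda>N. tail_sum b \<zeta> t N - wsum b \<zeta> t N) \<longlonglongrightarrow> 0"
proof -
  have "(\<lambda>N. kcoeff b (Suc j) / b ^ (N * Suc j) * wsum b \<zeta> (t - Suc j) N) \<longlonglongrightarrow> 0"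
    if "j < t" for j
  proof (rule tendsto_0_le)
    show "(\<lambda>N. (real N + 1) / b ^ N) \<longlonglongrightarrow> 0"
      using tendsto_n_over_power[of b] b by simp
    have "\<bar>wsum b \<zeta> (t - Suc j) N / b ^ (N * Suc j)\<bar> \<le> (real N + 1) / b ^ N" for N
    proof (cases "t - Suc j")
      case 0
      with that t have "2 \<le> Suc j" by simp
      then have "b ^ (N * 2) \<le> b ^ (N * Suc j)" using b by (intro power_increasing) auto
      then have "\<bar>wsum b \<zeta> 0 N / b ^ (N * Suc j)\<bar> \<le> b ^ N / b ^ (N * 2)"
        using abs_wsum_0_le[where N = N, OF \<zeta>] b by (auto simp: abs_divide intro!: frac_le)
      also have "\<dots> = 1 / b ^ N" using b by (simp add: power_add mult_2_right)
      also have "\<dots> \<le> (real N + 1) / b ^ N" using b by (intro divide_right_mono) auto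
      finally show ?thesis using 0 by simp
    next
      case (Suc u)
      have "b ^ (N * 1) \<le> b ^ (N * Suc j)" using b by (intro power_increasing) auto
      then show ?thesis
        unfolding Suc using abs_wsum_Suc_le[where t = u and N = N, OF \<zeta> b] b
        by (auto simp: abs_divide simp del: mult_Suc_right intro!: frac_le)
    qed
    then have "\<bar>kcoeff b (Suc j)\<bar> * \<bar>wsum b \<zeta> (t - Suc j) N / b ^ (N * Suc j)\<bar>
        \<le> \<bar>kcoeff b (Suc j)\<bar> * ((real N + 1) / b ^ N)" for N
      by (intro mult_left_mono) auto
    then show "\<forall>\<^sub>F N in sequentially.
        norm (kcoeff b (Suc j) / b ^ (N * Suc j) * wsum b \<zeta> (t - Suc j) N)
        \<le> norm ((real N + 1) / b ^ N) * \<bar>kcoeff b (Suc j)\<bar>"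
      using b by (simp add: abs_mult abs_divide mult_ac)
  qed
  then have "(\<lambda>N. \<Sum>j<t. kcoeff b (Suc j) / b ^ (N * Suc j) * wsum b \<zeta> (t - Suc j) N) \<longlonglongrightarrow> 0"
    by (intro tendsto_null_sum) auto
  moreover have "tail_sum b \<zeta> t N - wsum b \<zeta> t N =
      (\<Sum>j<t. kcoeff b (Suc j) / b ^ (N * Suc j) * wsum b \<zeta> (t - Suc j) N)" for N
    unfolding tail_sum_def lessThan_Suc_atMost[symmetric] sum.lessThan_Suc_shift by simp
  ultimately show ?thesis by simp
qed

text \<open>Once the product \<open>wsum b \<zeta> 0\<close> vanishes it stays 0. Then
  \<open>tail_sum\<close> is constant from \<open>n\<close> on, and its summand \<open>j = t\<close>
  drops out.\<close>

lemma wsum_tendsto_pos: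
  assumes \<zeta>: "\<And>a. \<zeta> a = b - 1 \<or> \<zeta> a = - 1" and b: "2 \<le> b" and t: "2 \<le> t"
    and n: "\<And>a. n \<le> a \<Longrightarrow> \<zeta> a = b - 1" and zero: "wsum b \<zeta> 0 n = 0"
  shows "wsum b \<zeta> t \<longlonglongrightarrow> (\<Sum>j<t. kcoeff b j / b ^ (n * j) * wsum b \<zeta> (t - j) n)"
proof -
  have wsum0: "wsum b \<zeta> 0 N = 0" if "n \<le> N" for N
    using that by (induction rule: dec_induct) (use zero in auto)
  have const: "tail_sum b \<zeta> t N = tail_sum b \<zeta> t n" if "n \<le> N" for N
    using that
  proof (induction rule: dec_induct)
    case (step N)
    then show ?case
      using tail_sum_Suc[of b \<zeta> N t] n[of N] wsum0[of N] wsum0[of "Suc N"] b by simp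
  qed simp
  have "tail_sum b \<zeta> t \<longlonglongrightarrow> tail_sum b \<zeta> t n"
    by (intro tendsto_eventually eventually_sequentiallyI[of n] const)
  from tendsto_diff[OF this tail_sum_minus_wsum[where \<zeta> = \<zeta>, OF \<zeta> b t]]
  have "wsum b \<zeta> t \<longlonglongrightarrow> tail_sum b \<zeta> t n" by simp
  also have "tail_sum b \<zeta> t n = (\<Sum>j<t. kcoeff b j / b ^ (n * j) * wsum b \<zeta> (t - j) n)"
    using zero by (simp add: tail_sum_def flip: lessThan_Suc_atMost)
  finally show ?thesis .
qed

lemma wsum_tendsto_zero:
  assumes b: "2 \<le> (b :: real)" and t: "2 \<le> t"
  shows "wsum b (\<lambda>_. b - 1) t \<longlonglongrightarrow>
    (\<Sum>j<t. kcoeff b j) + (b - 1) / (b ^ t - b) * kcoeff b (t - 1)"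
proof -
  let ?\<zeta> = "\<lambda>_ :: nat. b - 1"
  obtain u where u: "t = Suc u" "1 \<le> u" using t by (cases t) auto
  have wsum0: "wsum b ?\<zeta> 0 N = b ^ N" for N by simp
  have one: "1 < b ^ u" using u b by (intro one_less_power) auto
  \<comment> \<open>\<open>D\<close> is the sum of all increments of \<open>tail_sum\<close>, a
    geometric series with ratio \<open>1 / b ^ u\<close>.\<close>
  define D where "D = kcoeff b t * ((b - 1) / (b ^ t - b))"
  define q where "q = (\<lambda>N. (1 / b ^ u) ^ N)"
  have geo: "tail_sum b ?\<zeta> t N = (\<Sum>j\<le>t. kcoeff b j) + D * (1 - q N)" for N
  proof (induction N)
    case 0
    have "wsum b ?\<zeta> s 0 = 1" for s by (cases s) auto
    then show ?case by (simp add: tail_sum_def q_def)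
  next
    case (Suc N)
    have "b ^ (Suc N * t) = b ^ N * b * (b ^ u) ^ Suc N"
    proof -
      have "Suc N * t = Suc N + u * Suc N" by (simp add: u)
      then show ?thesis by (simp only: power_add power_mult power_Suc2)
    qed
    then have "kcoeff b t / b ^ (Suc N * t) * (b ^ Suc N - b ^ N) = D * (q N - q (Suc N))"
      using b one unfolding u D_def q_def
      by (simp add: power_divide divide_simps) (simp add: algebra_simps)
    then show ?case
      using Suc tail_sum_Suc[of b ?\<zeta> N t] b unfolding wsum0 by (simp add: right_diff_distrib)
  qed
  have "q \<longlonglongrightarrow> 0"
    unfolding q_def using one by (intro LIMSEQ_power_zero) simp
  then have "tail_sum b ?\<zeta> t \<longlonglongrightarrow> (\<Sum>j\<le>t. kcoeff b j) + D * (1 - 0)"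
    unfolding geo by (intro tendsto_intros)
  moreover have "(\<lambda>N. tail_sum b ?\<zeta> t N - wsum b ?\<zeta> t N) \<longlonglongrightarrow> 0"
    by (rule tail_sum_minus_wsum) (use b t in auto)
  ultimately have "(\<lambda>N. tail_sum b ?\<zeta> t N - (tail_sum b ?\<zeta> t N - wsum b ?\<zeta> t N)) \<longlonglongrightarrow>
      (\<Sum>j\<le>t. kcoeff b j) + D * (1 - 0) - 0"
    by (rule tendsto_diff)
  then have "wsum b ?\<zeta> t \<longlonglongrightarrow> (\<Sum>j\<le>t. kcoeff b j) + kcoeff b t * ((b - 1) / (b ^ t - b))"
    by (simp add: D_def)
  also have "(\<Sum>j\<le>t. kcoeff b j) + kcoeff b t * ((b - 1) / (b ^ t - b)) =
      (\<Sum>j<t. kcoeff b j) + kcoeff b t * (1 + (b - 1) / (b ^ t - b))"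
    by (simp add: algebra_simps flip: lessThan_Suc_atMost)
  \<comment> \<open>The summand \<open>j = t\<close> is merged with \<open>D\<close>; the numerator
    \<open>b ^ t - 1\<close> cancels the last denominator in \<open>kcoeff b t\<close>.\<close>
  also have "1 + (b - 1) / (b ^ t - b) = (b ^ t - 1) / (b ^ t - b)"
    using one b unfolding u by (simp add: divide_simps)
  also have "kcoeff b t * \<dots> = (b - 1) / (b ^ t - b) * kcoeff b (t - 1)"
    using kcoeff_Suc[of b u] b unfolding u by (simp add: mult_ac)
  finally show ?thesis .
qed

text \<open>Sort the \<open>k\<close> by their number of non-zero digits. Those with
  \<open>s \<le> t\<close> of them give the unweighted sums; for the others the \<open>t + 1\<close>
  largest positions are counted, and the free digits below the smallest of these sum to
  \<open>wsum b \<zeta> 0\<close>.\<close>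

lemma wsum_eq_tri:
  fixes g w :: "nat \<Rightarrow> real"
  assumes "\<And>a. g a = \<zeta> a / b ^ Suc a" "\<And>a. w a = wsum b \<zeta> 0 a"
  shows "wsum b \<zeta> (Suc t) N = (\<Sum>s\<le>t. tri g (\<lambda>_. 1) s N) + tri g w (Suc t) N"
proof (induction N arbitrary: t)
  case 0
  show ?case by (simp add: sum.atMost_shift)
next
  case (Suc N)
  show ?case
  proof (cases t)
    case 0
    then show ?thesis using Suc[of 0] assms by (simp add: tri_Suc_Suc mult_ac)
  next
    case (Suc u)
    have "(\<Sum>s\<le>t. tri g (\<lambda>_. 1) s (Suc N)) =
        (\<Sum>s\<le>t. tri g (\<lambda>_. 1) s N) + g N * (\<Sum>s\<le>u. tri g (\<lambda>_. 1) s N)"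
      unfolding Suc sum.atMost_Suc_shift
      by (simp add: tri_Suc_Suc sum.distrib sum_distrib_left)
    then show ?thesis
      using Suc.IH[of t] Suc.IH[of u] Suc assms(1)[of N] by (simp add: tri_Suc_Suc algebra_simps)
  qed
qed

section \<open>The digits of \<open>x\<close>\<close>

lemma z_cases: "z b x a = real b - 1 \<or> z b x a = - 1"
  by (simp add: z_def)

lemma wsum_0_z:
  assumes b: "2 \<le> b" and x: "0 \<le> x" "x < 1"
  shows "wsum (real b) (z b x) 0 N = real b ^ N * of_bool (x * real b ^ N < 1)"
proof (induction N)
  case (Suc N)
  have nonneg: "0 \<le> x * real b ^ Suc N" using x by simp
  have "x * real b ^ N \<le> x * real b ^ Suc N"
    using b x by (intro mult_left_mono power_increasing) auto
  \<comment> \<open>As long as \<open>x * b ^ N < 1\<close>, the integer part of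
    \<open>x * b ^ Suc N\<close> is below \<open>b\<close>, so reduction modulo \<open>b\<close> has
    no effect on it.\<close>
  moreover have "xdigit b x (N + 1) = 0 \<longleftrightarrow> x * real b ^ Suc N < 1" if "x * real b ^ N < 1"
  proof -
    have "x * real b ^ Suc N < real b"
      using mult_strict_left_mono[OF that, of "real b"] b by (simp add: mult_ac)
    then have "nat \<lfloor>x * real b ^ Suc N\<rfloor> < b"
      using nonneg by (simp add: nat_less_iff floor_less_iff)
    then have "xdigit b x (N + 1) = nat \<lfloor>x * real b ^ Suc N\<rfloor>"
      by (simp add: xdigit_def)
    also have "\<dots> = 0 \<longleftrightarrow> x * real b ^ Suc N < 1"
      by (simp add: floor_le_iff)
    finally show ?thesis .
  qed
  ultimately show ?case
    using Suc by (auto simp: z_def of_bool_def simp del: power_Suc) (simp_all)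
qed (use x in simp)

text \<open>Together with \<open>wsum_0_z\<close> this identifies the bracket weight
  \<open>bw b x\<close> with \<open>wsum\<close> at index 0.\<close>

lemma le_beta_iff:
  assumes "2 \<le> b" "0 < x"
  shows "int a \<le> beta b x - 1 \<longleftrightarrow> x * real b ^ a < 1"
proof -
  have "int a \<le> beta b x - 1 \<longleftrightarrow> \<lfloor>log (real b) x\<rfloor> < - int a"
    by (auto simp: beta_def)
  also have "\<dots> \<longleftrightarrow> log (real b) x < - real a"
    by (simp add: floor_less_iff)
  also have "\<dots> \<longleftrightarrow> x < real b powr (- real a)"
    using assms by (simp add: log_less_iff)
  also have "\<dots> \<longleftrightarrow> x * real b ^ a < 1"
    using assms by (simp add: powr_minus powr_realpow field_simps)
  finally show ?thesis .
qed

lemma xdigit_eq_0: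
  assumes "2 \<le> b" "n < i"
  shows "xdigit b (real v / real b ^ n) i = 0"
proof -
  \<comment> \<open>Beyond position \<open>n\<close> the scaled number is an integer multiple of
    \<open>b\<close>.\<close>
  obtain d where "i = n + Suc d" using assms(2) by (metis less_iff_Suc_add add_Suc_right)
  then have "real v / real b ^ n * real b ^ i = real (v * b ^ d * b)"
    using assms(1) by (simp add: power_add)
  then show ?thesis unfolding xdigit_def by (simp only: floor_of_nat nat_int) simp
qed

lemma z_0: "z b 0 = (\<lambda>_. real b - 1)"
  by (auto simp: z_def xdigit_def)

section \<open>From block sums to the Walsh series\<close>

lemma wal_0_right [simp]: "wal b k 0 = 1"
  by (simp add: wal_def xdigit_def)

lemma norm_wal [simp]: "norm (wal b k x) = 1"
proof -
  show ?thesis unfolding wal_def exp_eq_cis by (rule norm_cis)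
qed

text \<open>At \<open>x = 0\<close> all Walsh values are 1, so the block sums of the weights form a
  convergent \<open>wsum\<close>. As \<open>m < b ^ m\<close> and the weights are nonnegative, its
  bound holds for all partial sums.\<close>

lemma summable_r_weight:
  assumes b: "2 \<le> b" and \<alpha>: "2 \<le> \<alpha>"
  shows "summable (r_weight \<alpha> b)"
proof -
  have "convergent (wsum (real b) (\<lambda>_. real b - 1) \<alpha>)"
    using wsum_tendsto_zero[OF _ \<alpha>, of "real b"] b by (auto simp: convergent_def)
  then obtain B where B: "wsum (real b) (\<lambda>_. real b - 1) \<alpha> N \<le> B" for N
    by (metis convergent_imp_Bseq Bseq_def real_norm_def abs_le_iff)
  have "(\<Sum>k<m. r_weight \<alpha> b k) \<le> B" for m
  proof -
    have "m < b ^ m"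
      using power_gt_expt[of b m] b by simp
    then have "(\<Sum>k<m. r_weight \<alpha> b k) \<le> (\<Sum>k<b ^ m. r_weight \<alpha> b k)"
      by (intro sum_mono2) (auto simp: r_weight_nonneg)
    also have "\<dots> = wsum (real b) (\<lambda>_. real b - 1) \<alpha> m"
      using sum_r_weight_wal[OF b, of \<alpha> 0 m] by (simp add: z_0 flip: of_real_sum)
    finally show ?thesis using B[of m] by linarith
  qed
  then show ?thesis by (intro summableI_nonneg_bounded) (auto simp: r_weight_nonneg)
qed

text \<open>By absolute convergence the limit may be taken along the powers of \<open>b\<close>. The
  1 subtracted is the term \<open>k = 0\<close>, which \<open>omega\<close> leaves out.\<close>

lemma omega_eqI:
  assumes b: "2 \<le> b" and \<alpha>: "2 \<le> \<alpha>" and L: "wsum (real b) (z b x) \<alpha> \<longlonglongrightarrow> L"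
  shows "omega \<alpha> b x = of_real (L - 1)"
proof -
  let ?f = "\<lambda>k. of_real (r_weight \<alpha> b k) * wal b k x :: complex"
  have "summable ?f"
    by (rule summable_norm_cancel)
      (use summable_r_weight[OF b \<alpha>] in \<open>simp add: norm_mult r_weight_nonneg\<close>)
  have "filterlim (\<lambda>N. b ^ N) sequentially sequentially"
  proof (rule filterlim_subseq)
    show "strict_mono (\<lambda>N. b ^ N)" using b by (intro strict_monoI power_strict_increasing) auto
  qed
  from filterlim_compose[OF summable_LIMSEQ[OF \<open>summable ?f\<close>] this]
  have "(\<lambda>N. of_real (wsum (real b) (z b x) \<alpha> N) :: complex) \<longlonglongrightarrow> suminf ?f"
    by (simp add: sum_r_weight_wal[OF b])
  with tendsto_of_real[OF L] have "suminf ?f = of_real L"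
    using LIMSEQ_unique by blast
  then show ?thesis
    using suminf_split_head[OF \<open>summable ?f\<close>] by (simp add: omega_def)
qed

section \<open>The closed formulas\<close>

lemma C_entry_eq: "C_entry b n t = kcoeff (real b) t / real b ^ (n * t)"
  by (simp add: C_entry_def kcoeff_def)

lemma omega_pos:
  assumes \<alpha>: "2 \<le> \<alpha>" and b: "2 \<le> b" and n: "1 \<le> n" and v: "0 < v" "v < b ^ n"
  defines "x \<equiv> real v / real b ^ n"
  shows "omega \<alpha> b x = of_real (dot (take (\<alpha> - 1) (Cbar_vec \<alpha> b n)) (T_vec \<alpha> b n x)
    + (Cbar_entry b n (\<alpha> - 1) - 1) + dot (C_vec \<alpha> b n) (Tt_vec \<alpha> b n x))"
proof -
  have "real v < real b ^ n" using v by (metis of_nat_less_iff of_nat_power)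
  then have x: "0 < x" "x < 1" using v b by (simp_all add: x_def)
  let ?E = "\<lambda>t. tri (zg b x) (\<lambda>_. 1) t n"
  let ?F = "\<lambda>t. tri (zg b x) (bw b x) t n"
  let ?c = "C_entry b n"
  \<comment> \<open>Some digit among the first \<open>n\<close> is non-zero, because
    \<open>x * b ^ n = v \<ge> 1\<close>.\<close>
  have "wsum (real b) (z b x) 0 n = 0"
    using wsum_0_z[OF b, of x n] x v b by (simp add: x_def)
  moreover have "z b x a = real b - 1" if "n \<le> a" for a
    using xdigit_eq_0[OF b, of n "a + 1" v] that by (simp add: z_def x_def)
  ultimately have "wsum (real b) (z b x) \<alpha> \<longlonglongrightarrow> (\<Sum>j<\<alpha>. ?c j * wsum (real b) (z b x) (\<alpha> - j) n)"
    unfolding C_entry_eq using b \<alpha> by (intro wsum_tendsto_pos) (auto simp: z_cases)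
  then have "omega \<alpha> b x = of_real ((\<Sum>j<\<alpha>. ?c j * wsum (real b) (z b x) (\<alpha> - j) n) - 1)"
    by (rule omega_eqI[OF b \<alpha>])
  also have "(\<Sum>j<\<alpha>. ?c j * wsum (real b) (z b x) (\<alpha> - j) n) =
      (\<Sum>j<\<alpha>. \<Sum>t | t \<in> {..<\<alpha>} \<and> j + t < \<alpha>. ?c j * ?E t) + (\<Sum>j<\<alpha>. ?c j * ?F (\<alpha> - j))"
  proof -
    have "wsum (real b) (z b x) (\<alpha> - j) n = (\<Sum>t | t \<in> {..<\<alpha>} \<and> j + t < \<alpha>. ?E t) + ?F (\<alpha> - j)"
      if "j < \<alpha>" for j
    proof -
      have "wsum (real b) (z b x) (Suc (\<alpha> - Suc j)) n =
          (\<Sum>t\<le>\<alpha> - Suc j. ?E t) + ?F (Suc (\<alpha> - Suc j))"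
        by (rule wsum_eq_tri)
          (simp, simp only: wsum_0_z[OF b less_imp_le[OF x(1)] x(2)] le_beta_iff[OF b x(1)])
      also have "{..\<alpha> - Suc j} = {t. t \<in> {..<\<alpha>} \<and> j + t < \<alpha>}" using that by auto
      finally show ?thesis using that by (simp add: Suc_diff_Suc)
    qed
    then show ?thesis
      by (simp add: distrib_left sum.distrib sum_distrib_left)
  qed
  also have "(\<Sum>j<\<alpha>. \<Sum>t | t \<in> {..<\<alpha>} \<and> j + t < \<alpha>. ?c j * ?E t) =
      (\<Sum>t<\<alpha>. \<Sum>j | j \<in> {..<\<alpha>} \<and> j + t < \<alpha>. ?c j * ?E t)"
    by (rule sum.swap_restrict) auto
  \<comment> \<open>For fixed \<open>t\<close> the index \<open>j\<close> runs up to
    \<open>\<alpha> - 1 - t\<close>, so the coefficients accumulate to an entry of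
    \<open>Cbar_vec\<close>.\<close>
  also have "\<dots> = (\<Sum>t<\<alpha>. Cbar_entry b n (\<alpha> - Suc t) * ?E t)"
  proof (rule sum.cong[OF refl])
    fix t assume "t \<in> {..<\<alpha>}"
    then have "{j. j \<in> {..<\<alpha>} \<and> j + t < \<alpha>} = {..\<alpha> - Suc t}" by auto
    then show "(\<Sum>j | j \<in> {..<\<alpha>} \<and> j + t < \<alpha>. ?c j * ?E t) = Cbar_entry b n (\<alpha> - Suc t) * ?E t"
      by (simp add: Cbar_entry_def sum_distrib_right)
  qed
  also have "\<dots> = (\<Sum>j<\<alpha>. Cbar_entry b n j * ?E (\<alpha> - Suc j))"
    by (subst sum.nat_diff_reindex[symmetric]) (auto intro!: sum.cong)
  \<comment> \<open>The last summand belongs to the empty tuple, whose triangular sum is 1.\<close>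
  also have "\<dots> = (\<Sum>j<\<alpha> - 1. Cbar_entry b n j * ?E (\<alpha> - 1 - j)) + Cbar_entry b n (\<alpha> - 1)"
    using \<alpha> by (cases \<alpha>) auto
  also have "(\<Sum>j<\<alpha>. ?c j * ?F (\<alpha> - j)) = dot (C_vec \<alpha> b n) (Tt_vec \<alpha> b n x)"
    unfolding dot_C_Tt using n by (intro sum.cong) (auto simp: Tt_entry_eq)
  also have "(\<Sum>j<\<alpha> - 1. Cbar_entry b n j * ?E (\<alpha> - 1 - j)) =
      dot (take (\<alpha> - 1) (Cbar_vec \<alpha> b n)) (T_vec \<alpha> b n x)"
    using \<alpha> n by (subst dot_Cbar_T) (simp_all add: T_entry_eq)
  finally show ?thesis by (simp add: algebra_simps)
qed

lemma omega_0:
  assumes \<alpha>: "2 \<le> \<alpha>" and b: "2 \<le> b"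
  shows "omega \<alpha> b 0 = of_real ((\<Sum>r=1..\<alpha> - 1. \<Prod>i=1..r. (real b - 1) / (real b ^ i - 1))
    + (real b - 1) / (real b ^ \<alpha> - real b) * (\<Prod>i=1..\<alpha> - 1. (real b - 1) / (real b ^ i - 1)))"
proof -
  have "wsum (real b) (z b 0) \<alpha> \<longlonglongrightarrow> (\<Sum>j<\<alpha>. kcoeff (real b) j) +
      (real b - 1) / (real b ^ \<alpha> - real b) * kcoeff (real b) (\<alpha> - 1)"
    unfolding z_0 by (rule wsum_tendsto_zero) (use b \<alpha> in auto)
  from omega_eqI[OF b \<alpha> this] have "omega \<alpha> b 0 = of_real ((\<Sum>j<\<alpha>. kcoeff (real b) j) +
      (real b - 1) / (real b ^ \<alpha> - real b) * kcoeff (real b) (\<alpha> - 1) - 1)" .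
  \<comment> \<open>The coefficient with index 0 is 1 and cancels the subtracted term
    \<open>k = 0\<close>.\<close>
  also have "{..<\<alpha>} = insert 0 {1..\<alpha> - 1}" using \<alpha> by auto
  also have "sum (kcoeff (real b)) \<dots> = 1 + (\<Sum>r=1..\<alpha> - 1. kcoeff (real b) r)"
    by simp
  finally show ?thesis
    unfolding kcoeff_def[symmetric] by (simp only: add_diff_eq add.commute add_diff_cancel_left' add.assoc)
qed

theorem theorem2:
  shows "\<exists>K :: nat. \<forall>\<alpha> b n v :: nat. 2 \<le> \<alpha> \<longrightarrow> 2 \<le> b \<longrightarrow> 1 \<le> n \<longrightarrow> v < b ^ n \<longrightarrow>
    (let x = real v / real b ^ n in
      omega \<alpha> b x = complex_of_real
        (if 0 < v
         then dot (take (\<alpha> - 1) (Cbar_vec \<alpha> b n)) (T_vec \<alpha> b n x)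
              + (Cbar_entry b n (\<alpha> - 1) - 1)
              + dot (C_vec \<alpha> b n) (Tt_vec \<alpha> b n x)
         else (\<Sum>r=1..\<alpha> - 1. \<Prod>i=1..r. (real b - 1) / (real b ^ i - 1))
              + (real b - 1) / (real b ^ \<alpha> - real b)
                * (\<Prod>i=1..\<alpha> - 1. (real b - 1) / (real b ^ i - 1)))
      \<and> (0 < v \<longrightarrow> (\<forall>s.
            map (\<lambda>t. run (g_val \<alpha> b x) (prog_T \<alpha> n) s (RegS t)) [1..<\<alpha>] = T_vec \<alpha> b n x
          \<and> map (\<lambda>t. run (g_val \<alpha> b x) (prog_Tt \<alpha> n) s (RegSt t)) [1..<\<alpha> + 1] = Tt_vec \<alpha> b n x))
      \<and> (\<forall>s. s Base = real b \<longrightarrow>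
            omega \<alpha> b x = complex_of_real (run (g_val \<alpha> b x) (omega_prog \<alpha> n v) s Out))
      \<and> length (omega_prog \<alpha> n v) \<le> K * \<alpha> * n)"
proof (intro exI[of _ 60] allI impI)
  fix \<alpha> b n v :: nat
  assume *: "2 \<le> \<alpha>" "2 \<le> b" "1 \<le> n" "v < b ^ n"
  show "let x = real v / real b ^ n in
      omega \<alpha> b x = complex_of_real
        (if 0 < v
         then dot (take (\<alpha> - 1) (Cbar_vec \<alpha> b n)) (T_vec \<alpha> b n x)
              + (Cbar_entry b n (\<alpha> - 1) - 1)
              + dot (C_vec \<alpha> b n) (Tt_vec \<alpha> b n x)
         else (\<Sum>r=1..\<alpha> - 1. \<Prod>i=1..r. (real b - 1) / (real b ^ i - 1))
              + (real b - 1) / (real b ^ \<alpha> - real b)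
                * (\<Prod>i=1..\<alpha> - 1. (real b - 1) / (real b ^ i - 1)))
      \<and> (0 < v \<longrightarrow> (\<forall>s.
            map (\<lambda>t. run (g_val \<alpha> b x) (prog_T \<alpha> n) s (RegS t)) [1..<\<alpha>] = T_vec \<alpha> b n x
          \<and> map (\<lambda>t. run (g_val \<alpha> b x) (prog_Tt \<alpha> n) s (RegSt t)) [1..<\<alpha> + 1] = Tt_vec \<alpha> b n x))
      \<and> (\<forall>s. s Base = real b \<longrightarrow>
            omega \<alpha> b x = complex_of_real (run (g_val \<alpha> b x) (omega_prog \<alpha> n v) s Out))
      \<and> length (omega_prog \<alpha> n v) \<le> 60 * \<alpha> * n"
  proof (cases "v = 0")
    case True
    then have "omega_prog \<alpha> n v = prog_zero \<alpha>" by (simp add: omega_prog_def)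
    then show ?thesis
      using True * omega_0[of \<alpha> b] run_prog_zero[of \<alpha> _ b] length_omega_prog[of \<alpha> n v]
      by (simp add: Let_def)
  next
    case False
    then have "0 < v" by simp
    then show ?thesis
      unfolding Let_def if_P[OF \<open>0 < v\<close>]
      using omega_pos[OF *(1,2,3) _ *(4)] run_omega_prog_pos[OF *(1,3)] run_T_vec[OF *(1,3)]
        run_Tt_vec[OF *(1,3)] length_omega_prog[OF *(1,3)]
      by (intro conjI impI allI) simp_all
  qed
qed

end
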